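(* Let $1\le d<\infty$ be an integer and let $X,X_n,Y$ be random variables in $\mathbb{R}^d$. (a) Let $\{X_n\}$ satisfy $E\|X_n\|<\infty$ for all $n\ge1$. Then the following are equivalent: (i) $W_1(X_n,X)\to0$; (ii) $W_1^*(X_n,X)\to0$; (iii) for every $f\in D_d$, $Ef(X_n)\to Ef(X)<\infty$. (b) For any $\epsilon>0$, let $T_\epsilon\subset S_d$ be a finite subset satisfying $\sup_{s\in S_d}\inf_{t\in T_\epsilon}\|s-t\|\le\epsilon$. Then $$\Big|W_1^*(X,Y)-\sup_{t\in T_\epsilon}W_1(t'X,t'Y)\Big|\le\epsilon\big(E\|X\|+E\|Y\|\big).$$
   Context: $\|\cdot\|$ is the Euclidean norm. $W_1(X,Y)=\inf_{\lambda\in\Gamma(X,Y)}E_\lambda\|X-Y\|$, where $\Gamma(X,Y)$ is the set of joint laws with marginals the laws of $X$ and $Y$ (for scalar random variables the norm is the absolute value). $S_d=\{t\in\mathbb{R}^d:\|t\|=1\}$, and the max-sliced Wasserstein distance is $W_1^*(X,Y)=\sup_{t\in S_d}W_1(t'X,t'Y)$. $D_d$ is the set of all continuous $f:\mathbb{R}^d\to\mathbb{R}$ with $\sup_{z\in\mathbb{R}^d}|f(z)|/(1\vee\|z\|)<\infty$. *)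

theory Defs
  imports "HOL-Probability.Probability"
begin

definition couplings :: "'a::euclidean_space measure \<Rightarrow> 'a measure \<Rightarrow> ('a \<times> 'a) measure set" where
  "couplings P Q = {L. prob_space L \<and> sets L = sets (borel :: ('a \<times> 'a) measure) \<and>
      distr L borel fst = P \<and> distr L borel snd = Q}"

definition W1 :: "'a::euclidean_space measure \<Rightarrow> 'a measure \<Rightarrow> ennreal" where
  "W1 P Q = (INF L \<in> couplings P Q. \<integral>\<^sup>+ z. ennreal (norm (fst z - snd z)) \<partial>L)"

definition proj_law :: "'a::euclidean_space \<Rightarrow> 'a measure \<Rightarrow> real measure" where
  "proj_law t P = distr P borel (\<lambda>x. t \<bullet> x)"

definition W1_star :: "'a::euclidean_space measure \<Rightarrow> 'a measure \<Rightarrow> ennreal" where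
  "W1_star P Q = (SUP t \<in> sphere (0::'a) 1. W1 (proj_law t P) (proj_law t Q))"

definition Dd :: "('a::euclidean_space \<Rightarrow> real) set" where
  "Dd = {f. continuous_on UNIV f \<and> bdd_above (range (\<lambda>z. \<bar>f z\<bar> / max 1 (norm z)))}"

end

theory Submission
  imports Defs
begin

text \<open>
  On the real line \<open>W\<^sub>1\<close> is the area between the distribution functions (the quantile coupling is
  optimal), so there it satisfies the triangle inequality without a gluing argument; this gives (b).

  For (ii) \<open>\<Longrightarrow>\<close> (iii), \<open>W\<^sub>1\<^sup>*\<close> controls the expectations of Lipschitz ridge functions \<open>g (t \<bullet> x)\<close>, hence
  of trigonometric sums and of the tails \<open>max 0 (\<bar>b \<bullet> x\<bar> - r)\<close>, and every \<open>f \<in> Dd\<close> is within \<open>\<delta>\<close> plus such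
  tails of a trigonometric sum.

  For (iii) \<open>\<Longrightarrow>\<close> (i), a finite continuous partition of a large ball into functions of small support
  yields a coupling that matches the common mass of each cell inside that cell and couples the rest
  independently; its cost depends only on expectations of functions in \<open>Dd\<close>.
\<close>

text \<open>The obstacle in (a) is linear growth: functions in \<open>Dd\<close> may be unbounded
  while trigonometric sums are bounded, so uniform approximation fails and the error contains a tail
  of order \<open>norm x\<close>. For d > 1 the norm is not a ridge function, hence the tail is
  dominated by one ridge function per coordinate; convergence of their expectations plays the role
  of uniform integrability. In (iii) to (i) the cells have to be continuous functions, since (iii)
  tests nothing else. Finiteness of E norm X is not assumed: under (ii) it comes from a single n
  with finite \<open>W1_star\<close>, under (iii) from \<open>norm\<close> being a member of
  \<open>Dd\<close>. The cycle closes because projecting onto a unit vector is a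
  contraction.\<close>

section \<open>Couplings and elementary bounds on \<open>W1\<close>\<close>

lemma couplingsD:
  assumes "L \<in> couplings P Q"
  shows "prob_space L" "sets L = sets borel" "P = distr L borel fst" "Q = distr L borel snd"
    "fst \<in> borel_measurable L" "snd \<in> borel_measurable L"
proof -
  show *: "prob_space L" "sets L = sets borel" "P = distr L borel fst" "Q = distr L borel snd"
    using assms by (auto simp: couplings_def)
  show "fst \<in> borel_measurable L" "snd \<in> borel_measurable L"
    unfolding measurable_cong_sets[OF *(2) refl]
    by (intro borel_measurable_continuous_onI continuous_intros)+
qed

text \<open>Upper bounds on \<open>W1\<close> come from here: two random variables on one
  probability space couple their own laws.\<close>

lemma W1_distr_le:
  fixes U V :: "'b \<Rightarrow> 'a::euclidean_space"
  assumes "prob_space N" and [measurable]: "U \<in> borel_measurable N" "V \<in> borel_measurable N"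
  shows "W1 (distr N borel U) (distr N borel V) \<le> (\<integral>\<^sup>+ w. ennreal (norm (U w - V w)) \<partial>N)"
proof -
  interpret prob_space N by fact
  let ?L = "distr N borel (\<lambda>w. (U w, V w))"
  have UV [measurable]: "(\<lambda>w. (U w, V w)) \<in> borel_measurable N"
    by measurable
  have fs [measurable]: "(fst :: 'a \<times> 'a \<Rightarrow> 'a) \<in> borel_measurable borel" "(snd :: 'a \<times> 'a \<Rightarrow> 'a) \<in> borel_measurable borel"
    by (intro borel_measurable_continuous_onI continuous_intros)+
  have "?L \<in> couplings (distr N borel U) (distr N borel V)"
    by (auto simp: couplings_def distr_distr comp_def prob_space_distr)
  then have "W1 (distr N borel U) (distr N borel V) \<le> (\<integral>\<^sup>+ z. ennreal (norm (fst z - snd z)) \<partial>?L)"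
    unfolding W1_def by (rule INF_lower)
  also have "\<dots> = (\<integral>\<^sup>+ w. ennreal (norm (U w - V w)) \<partial>N)"
    by (subst nn_integral_distr) auto
  finally show ?thesis .
qed

text \<open>The easy half of Kantorovich-Rubinstein duality: along any coupling, g changes by no
  more than the distance. Integrability guards against Bochner integrals that default to 0.\<close>

lemma expectation_diff_le_W1:
  fixes g :: "'a::euclidean_space \<Rightarrow> real"
  assumes g: "integrable P g" "integrable Q g" and lip: "\<And>x y. \<bar>g x - g y\<bar> \<le> norm (x - y)"
    and [measurable]: "g \<in> borel_measurable borel"
  shows "ennreal \<bar>(\<integral>x. g x \<partial>P) - (\<integral>x. g x \<partial>Q)\<bar> \<le> W1 P Q"
  unfolding W1_def
proof (rule INF_greatest)
  fix L assume "L \<in> couplings P Q"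
  note L = couplingsD[OF this]
  note [measurable] = L(5,6)
  have i: "integrable L (\<lambda>z. g (fst z))" "integrable L (\<lambda>z. g (snd z))"
    using g unfolding L(3,4) by (auto simp: integrable_distr_eq)
  have "(\<integral>x. g x \<partial>P) - (\<integral>x. g x \<partial>Q) = (\<integral>z. g (fst z) - g (snd z) \<partial>L)"
    using i unfolding L(3,4) by (simp add: integral_distr)
  then have "ennreal \<bar>(\<integral>x. g x \<partial>P) - (\<integral>x. g x \<partial>Q)\<bar> \<le> (\<integral>\<^sup>+z. norm (g (fst z) - g (snd z)) \<partial>L)"
    using integral_norm_bound_ennreal[of L "\<lambda>z. g (fst z) - g (snd z)"] i by simp
  also have "\<dots> \<le> (\<integral>\<^sup>+ z. ennreal (norm (fst z - snd z)) \<partial>L)"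
    using lip by (intro nn_integral_mono) (auto intro!: ennreal_leI)
  finally show "ennreal \<bar>(\<integral>x. g x \<partial>P) - (\<integral>x. g x \<partial>Q)\<bar> \<le> (\<integral>\<^sup>+ z. ennreal (norm (fst z - snd z)) \<partial>L)" .
qed

text \<open>A linear functional of norm at most 1 is a contraction, so projecting both coordinates
  of a coupling does not raise its cost.\<close>

lemma W1_proj_law_le:
  fixes t :: "'a::euclidean_space"
  assumes t: "norm t \<le> 1"
  shows "W1 (proj_law t P) (proj_law t Q) \<le> W1 P Q"
  unfolding W1_def[of P Q]
proof (rule INF_greatest)
  fix L assume "L \<in> couplings P Q"
  note L = couplingsD[OF this]
  note [measurable] = L(5,6)
  have "proj_law t P = distr L borel (\<lambda>z. t \<bullet> fst z)" "proj_law t Q = distr L borel (\<lambda>z. t \<bullet> snd z)"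
    unfolding proj_law_def L(3,4) by (simp_all add: distr_distr comp_def)
  then have "W1 (proj_law t P) (proj_law t Q) \<le> (\<integral>\<^sup>+ z. ennreal (norm (t \<bullet> fst z - t \<bullet> snd z)) \<partial>L)"
    using W1_distr_le[OF L(1), of "\<lambda>z. t \<bullet> fst z" "\<lambda>z. t \<bullet> snd z"] by simp
  also have "\<dots> \<le> (\<integral>\<^sup>+ z. ennreal (norm (fst z - snd z)) \<partial>L)"
  proof (intro nn_integral_mono ennreal_leI)
    fix z :: "'a \<times> 'a"
    have "norm (t \<bullet> (fst z - snd z)) \<le> norm t * norm (fst z - snd z)"
      by (metis Cauchy_Schwarz_ineq2 real_norm_def)
    also have "\<dots> \<le> 1 * norm (fst z - snd z)"
      using t by (intro mult_right_mono) auto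
    finally show "norm (t \<bullet> fst z - t \<bullet> snd z) \<le> norm (fst z - snd z)"
      by (simp add: inner_diff_right)
  qed
  finally show "W1 (proj_law t P) (proj_law t Q) \<le> (\<integral>\<^sup>+ z. ennreal (norm (fst z - snd z)) \<partial>L)" .
qed

lemma W1_star_le_W1: "W1_star P Q \<le> W1 P Q"
  unfolding W1_star_def by (intro SUP_least W1_proj_law_le) auto

section \<open>Transport on the real line\<close>

text \<open>Writes a distance as the length of an interval. The interval is half-open so that u
  belongs to it exactly when one of a <= u, b <= u holds and the other fails, which is the event
  that distribution functions see.\<close>

lemma nn_integral_abs_diff_indicator:
  fixes a b :: real
  shows "(\<integral>\<^sup>+u. indicator {min a b..<max a b} u \<partial>lborel) = ennreal \<bar>a - b\<bar>"
  by (simp add: min_def max_def abs_if)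

text \<open>In a coupling, the distribution functions differ at u by at most the probability that u
  separates the two coordinates. Integrating over u and exchanging the integrals turns this into the
  expected distance.\<close>

lemma cdf_area_le_W1:
  fixes P Q :: "real measure"
  shows "(\<integral>\<^sup>+u. ennreal \<bar>cdf P u - cdf Q u\<bar> \<partial>lborel) \<le> W1 P Q"
  unfolding W1_def
proof (rule INF_greatest)
  fix L :: "(real \<times> real) measure" assume "L \<in> couplings P Q"
  note L = couplingsD[OF this]
  note [measurable] = L(5,6)
  interpret prob_space L by fact
  interpret pair_sigma_finite L lborel ..
  have sp: "space L = UNIV" using sets_eq_imp_space_eq[OF L(2)] by simp
  have meas: "(\<lambda>(z, u). indicator {min (fst z) (snd z)..<max (fst z) (snd z)} u) \<in> borel_measurable (L \<Otimes>\<^sub>M lborel)"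
    unfolding indicator_def atLeastLessThan_iff of_bool_def by measurable
  have 1: "ennreal \<bar>cdf P u - cdf Q u\<bar> \<le> (\<integral>\<^sup>+z. indicator {min (fst z) (snd z)..<max (fst z) (snd z)} u \<partial>L)" for u
  proof -
    let ?A = "{z. fst z \<le> u}" and ?B = "{z. snd z \<le> u}"
    have A [measurable]: "?A \<in> sets L" "?B \<in> sets L"
      using measurable_sets[OF L(5), of "{..u}"] measurable_sets[OF L(6), of "{..u}"]
      by (simp_all add: vimage_def sp)
    have c: "cdf P u = prob ?A" "cdf Q u = prob ?B"
      unfolding L(3,4) cdf_def by (simp_all add: measure_distr vimage_def sp)
    have "\<bar>prob ?A - prob ?B\<bar> \<le> prob ((?A - ?B) \<union> (?B - ?A))"
    proof -
      have "prob ?A \<le> prob (?B \<union> ((?A - ?B) \<union> (?B - ?A)))"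
        by (intro finite_measure_mono sets.Un sets.Diff A) auto
      also have "\<dots> \<le> prob ?B + prob ((?A - ?B) \<union> (?B - ?A))"
        by (intro measure_Un_le sets.Un sets.Diff A)
      finally have 1: "prob ?A \<le> prob ?B + prob ((?A - ?B) \<union> (?B - ?A))" .
      have "prob ?B \<le> prob (?A \<union> ((?A - ?B) \<union> (?B - ?A)))"
        by (intro finite_measure_mono sets.Un sets.Diff A) auto
      also have "\<dots> \<le> prob ?A + prob ((?A - ?B) \<union> (?B - ?A))"
        by (intro measure_Un_le sets.Un sets.Diff A)
      finally show ?thesis using 1 by linarith
    qed
    then have "ennreal \<bar>cdf P u - cdf Q u\<bar> \<le> emeasure L ((?A - ?B) \<union> (?B - ?A))"
      unfolding c emeasure_eq_measure by (rule ennreal_leI)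
    also have "\<dots> = (\<integral>\<^sup>+z. indicator ((?A - ?B) \<union> (?B - ?A)) z \<partial>L)"
      by (intro nn_integral_indicator[symmetric] sets.Un sets.Diff A)
    also have "\<dots> = (\<integral>\<^sup>+z. indicator {min (fst z) (snd z)..<max (fst z) (snd z)} u \<partial>L)"
      by (intro nn_integral_cong) (auto simp: indicator_def)
    finally show ?thesis .
  qed
  have "(\<integral>\<^sup>+u. ennreal \<bar>cdf P u - cdf Q u\<bar> \<partial>lborel)
      \<le> (\<integral>\<^sup>+u. \<integral>\<^sup>+z. indicator {min (fst z) (snd z)..<max (fst z) (snd z)} u \<partial>L \<partial>lborel)"
    by (intro nn_integral_mono 1)
  also have "\<dots> = (\<integral>\<^sup>+z. \<integral>\<^sup>+u. indicator {min (fst z) (snd z)..<max (fst z) (snd z)} u \<partial>lborel \<partial>L)"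
    using meas by (rule Fubini')
  also have "\<dots> = (\<integral>\<^sup>+ z. ennreal (norm (fst z - snd z)) \<partial>L)"
    unfolding nn_integral_abs_diff_indicator by simp
  finally show "(\<integral>\<^sup>+u. ennreal \<bar>cdf P u - cdf Q u\<bar> \<partial>lborel) \<le> (\<integral>\<^sup>+ z. ennreal (norm (fst z - snd z)) \<partial>L)" .
qed

text \<open>Quantile coupling: \<open>I\<close> is the generalized inverse of the distribution
  function, and under Lebesgue measure on (0,1) it has the given law. Exchanging integrals leaves
  the length of the set of levels w whose two quantiles are separated by u.\<close>

lemma W1_le_cdf_area:
  fixes P Q :: "real measure"
  assumes "real_distribution P" "real_distribution Q"
  shows "W1 P Q \<le> (\<integral>\<^sup>+u. ennreal \<bar>cdf P u - cdf Q u\<bar> \<partial>lborel)"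
proof -
  interpret P: cdf_distribution P unfolding cdf_distribution_def by fact
  interpret Q: cdf_distribution Q unfolding cdf_distribution_def by fact
  let ?\<Omega> = "restrict_space lborel {0<..<1::real}"
  interpret \<Omega>: prob_space ?\<Omega>
    by (auto simp add: emeasure_restrict_space space_restrict_space intro!: prob_spaceI)
  interpret pair_sigma_finite ?\<Omega> lborel ..
  have m: "P.I \<in> borel_measurable ?\<Omega>" "Q.I \<in> borel_measurable ?\<Omega>"
    using P.measurable_CI Q.measurable_CI by (simp_all add: measurable_cong_sets[OF sets_restrict_space_cong[OF sets_lborel] refl])
  define p q where "p = P.I" and "q = Q.I"
  have [measurable]: "p \<in> borel_measurable ?\<Omega>" "q \<in> borel_measurable ?\<Omega>"
    using m by (simp_all add: p_def q_def)
  have meas: "(\<lambda>(w, u). indicator {min (p w) (q w)..<max (p w) (q w)} u) \<in> borel_measurable (?\<Omega> \<Otimes>\<^sub>M lborel)"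
    unfolding indicator_def atLeastLessThan_iff of_bool_def by measurable
  have "W1 P Q = W1 (distr ?\<Omega> borel p) (distr ?\<Omega> borel q)"
    by (simp add: P.distr_I_eq_M Q.distr_I_eq_M p_def q_def)
  also have "\<dots> \<le> (\<integral>\<^sup>+ w. ennreal (norm (p w - q w)) \<partial>?\<Omega>)"
    by (intro W1_distr_le \<Omega>.prob_space_axioms) auto
  also have "\<dots> = (\<integral>\<^sup>+w. \<integral>\<^sup>+u. indicator {min (p w) (q w)..<max (p w) (q w)} u \<partial>lborel \<partial>?\<Omega>)"
    unfolding nn_integral_abs_diff_indicator by simp
  also have "\<dots> = (\<integral>\<^sup>+u. \<integral>\<^sup>+w. indicator {min (p w) (q w)..<max (p w) (q w)} u \<partial>?\<Omega> \<partial>lborel)"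
    using meas by (rule Fubini'[symmetric])
  also have "\<dots> \<le> (\<integral>\<^sup>+u. ennreal \<bar>cdf P u - cdf Q u\<bar> \<partial>lborel)"
  proof (rule nn_integral_mono)
    fix u :: real
    let ?J = "{min (cdf P u) (cdf Q u)<..max (cdf P u) (cdf Q u)}"
    \<comment> \<open>\<open>pseudoinverse\<close> says that the quantile at w is <= u iff w <=
      F(u). So u >= the smaller quantile becomes w <= the larger value, and u < the larger quantile
      becomes w > the smaller value: the open end changes sides.\<close>
    have J: "w \<in> ?J" if "w \<in> {0<..<1}" "u \<in> {min (p w) (q w)..<max (p w) (q w)}" for w
      using that P.pseudoinverse[of w u] Q.pseudoinverse[of w u]
      unfolding p_def q_def max_def min_def greaterThanLessThan_iff greaterThanAtMost_iff atLeastLessThan_iff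
        not_le[symmetric]
      by (auto split: if_splits)
    have "(\<integral>\<^sup>+w. indicator {min (p w) (q w)..<max (p w) (q w)} u \<partial>?\<Omega>)
        = (\<integral>\<^sup>+w. indicator {min (p w) (q w)..<max (p w) (q w)} u * indicator {0<..<1} w \<partial>lborel)"
      by (rule nn_integral_restrict_space) simp
    also have "\<dots> \<le> (\<integral>\<^sup>+w. indicator ?J w \<partial>lborel)"
      using J by (intro nn_integral_mono) (auto split: split_indicator)
    also have "\<dots> = ennreal \<bar>cdf P u - cdf Q u\<bar>"
      by (simp add: min_def max_def abs_if)
    finally show "(\<integral>\<^sup>+w. indicator {min (p w) (q w)..<max (p w) (q w)} u \<partial>?\<Omega>) \<le> ennreal \<bar>cdf P u - cdf Q u\<bar>" .
  qed
  finally show ?thesis .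
qed

lemma W1_triangle_real:
  fixes P Q R :: "real measure"
  assumes P: "real_distribution P" and Q: "real_distribution Q" and R: "real_distribution R"
  shows "W1 P R \<le> W1 P Q + W1 Q R"
proof -
  have [measurable]: "cdf S \<in> borel_measurable borel" if "real_distribution S" for S
    using that unfolding cdf_distribution_def[symmetric] by (rule cdf_distribution.measurable_C)
  note [measurable] = this[OF P] this[OF Q] this[OF R]
  have "W1 P R \<le> (\<integral>\<^sup>+u. ennreal \<bar>cdf P u - cdf R u\<bar> \<partial>lborel)"
    by (rule W1_le_cdf_area[OF P R])
  also have "\<dots> \<le> (\<integral>\<^sup>+u. ennreal \<bar>cdf P u - cdf Q u\<bar> + ennreal \<bar>cdf Q u - cdf R u\<bar> \<partial>lborel)"
    by (intro nn_integral_mono) (simp flip: ennreal_plus)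
  also have "\<dots> = (\<integral>\<^sup>+u. ennreal \<bar>cdf P u - cdf Q u\<bar> \<partial>lborel) + (\<integral>\<^sup>+u. ennreal \<bar>cdf Q u - cdf R u\<bar> \<partial>lborel)"
    by (intro nn_integral_add) auto
  also have "\<dots> \<le> W1 P Q + W1 Q R"
    by (intro add_mono cdf_area_le_W1)
  finally show ?thesis .
qed

section \<open>Finite nets of directions\<close>

text \<open>Replace s by a nearest net point t and return: the scalar triangle inequality runs
  through the laws of t'X and t'Y. Two projections of the same variable are already coupled, so each
  change of direction costs at most \<epsilon> times its first moment.\<close>

lemma W1_star_le_SUP_net:
  fixes X Y :: "'b \<Rightarrow> 'a::euclidean_space" and T :: "'a set"
  assumes M: "prob_space M" and [measurable]: "X \<in> borel_measurable M" "Y \<in> borel_measurable M"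
    and T: "finite T" "T \<noteq> {}" "T \<subseteq> sphere 0 1"
    and net: "(SUP s \<in> sphere (0::'a) 1. INF t \<in> T. norm (s - t)) \<le> \<epsilon>" and \<epsilon>: "0 \<le> \<epsilon>"
  defines "P \<equiv> distr M borel X" and "Q \<equiv> distr M borel Y"
  shows "W1_star P Q \<le> (SUP t\<in>T. W1 (proj_law t P) (proj_law t Q)) +
    ennreal \<epsilon> * ((\<integral>\<^sup>+\<omega>. ennreal (norm (X \<omega>)) \<partial>M) + (\<integral>\<^sup>+\<omega>. ennreal (norm (Y \<omega>)) \<partial>M))"
  unfolding W1_star_def
proof (rule SUP_least)
  interpret M: prob_space M by fact
  fix s :: 'a assume s: "s \<in> sphere 0 1"
  \<comment> \<open>\<open>net\<close> uses a real supremum, which bounds its members only once the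
    set is known to be bounded above.\<close>
  have bdd: "bdd_above ((\<lambda>s. INF t \<in> T. norm (s - t)) ` sphere (0::'a) 1)"
  proof (rule bdd_aboveI2)
    fix s :: 'a assume s: "s \<in> sphere 0 1"
    obtain t where "t \<in> T" using T by auto
    have "(INF t \<in> T. norm (s - t)) \<le> norm (s - t)"
      using \<open>t \<in> T\<close> by (intro cINF_lower) (auto intro!: bdd_belowI2[of _ 0])
    also have "\<dots> \<le> norm s + norm t" by (rule norm_triangle_ineq4)
    finally show "(INF t \<in> T. norm (s - t)) \<le> 2" using s T \<open>t \<in> T\<close> by auto
  qed
  \<comment> \<open>Finiteness of \<open>T\<close> makes the infimum attained, so a net point within
    \<epsilon> exists without slack.\<close>
  have "(INF t \<in> T. norm (s - t)) \<in> (\<lambda>t. norm (s - t)) ` T"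
    using T by (subst cInf_eq_Min) (auto intro!: Min_in)
  then obtain t where t: "t \<in> T" and eq: "(INF t \<in> T. norm (s - t)) = norm (s - t)" by auto
  have "norm (s - t) \<le> (SUP s \<in> sphere (0::'a) 1. INF t \<in> T. norm (s - t))"
    unfolding eq[symmetric] using s by (rule cSUP_upper[OF _ bdd])
  then have st: "norm (s - t) \<le> \<epsilon>" using net by linarith
  have proj: "proj_law r (distr M borel Z) = distr M borel (\<lambda>\<omega>. r \<bullet> Z \<omega>)"
    if [measurable]: "Z \<in> borel_measurable M" for Z and r :: 'a
    by (simp add: proj_law_def distr_distr comp_def)
  have rd: "real_distribution (proj_law r (distr M borel Z))"
    if [measurable]: "Z \<in> borel_measurable M" for Z and r :: 'a
    unfolding proj[OF that] by (rule M.real_distribution_distr) simp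
  have close: "W1 (proj_law r (distr M borel Z)) (proj_law r' (distr M borel Z))
      \<le> ennreal \<epsilon> * (\<integral>\<^sup>+\<omega>. ennreal (norm (Z \<omega>)) \<partial>M)"
    if [measurable]: "Z \<in> borel_measurable M" and r: "norm (r - r') \<le> \<epsilon>" for Z and r r' :: 'a
  proof -
    have "W1 (proj_law r (distr M borel Z)) (proj_law r' (distr M borel Z))
       \<le> (\<integral>\<^sup>+\<omega>. ennreal (norm (r \<bullet> Z \<omega> - r' \<bullet> Z \<omega>)) \<partial>M)"
      unfolding proj[OF that(1)] by (rule W1_distr_le) (use M in auto)
    also have "\<dots> \<le> (\<integral>\<^sup>+\<omega>. ennreal \<epsilon> * ennreal (norm (Z \<omega>)) \<partial>M)"
    proof (intro nn_integral_mono)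
      fix \<omega>
      have "norm (r \<bullet> Z \<omega> - r' \<bullet> Z \<omega>) \<le> norm (r - r') * norm (Z \<omega>)"
        unfolding inner_diff_left[symmetric] by (metis Cauchy_Schwarz_ineq2 real_norm_def)
      also have "\<dots> \<le> \<epsilon> * norm (Z \<omega>)" using r by (intro mult_right_mono) auto
      finally show "ennreal (norm (r \<bullet> Z \<omega> - r' \<bullet> Z \<omega>)) \<le> ennreal \<epsilon> * ennreal (norm (Z \<omega>))"
        using \<epsilon> by (simp flip: ennreal_mult add: ennreal_leI)
    qed
    also have "\<dots> = ennreal \<epsilon> * (\<integral>\<^sup>+\<omega>. ennreal (norm (Z \<omega>)) \<partial>M)"
      by (rule nn_integral_cmult) simp
    finally show ?thesis .
  qed
  have "W1 (proj_law s P) (proj_law s Q) \<le> W1 (proj_law s P) (proj_law t P) + W1 (proj_law t P) (proj_law s Q)"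
    unfolding P_def Q_def by (intro W1_triangle_real rd) auto
  also have "\<dots> \<le> W1 (proj_law s P) (proj_law t P) + (W1 (proj_law t P) (proj_law t Q) + W1 (proj_law t Q) (proj_law s Q))"
    unfolding P_def Q_def by (intro add_left_mono W1_triangle_real rd) auto
  also have "\<dots> \<le> ennreal \<epsilon> * (\<integral>\<^sup>+\<omega>. ennreal (norm (X \<omega>)) \<partial>M) +
      ((SUP t\<in>T. W1 (proj_law t P) (proj_law t Q)) + ennreal \<epsilon> * (\<integral>\<^sup>+\<omega>. ennreal (norm (Y \<omega>)) \<partial>M))"
    unfolding P_def Q_def using st t
    by (intro add_mono close SUP_upper) (auto simp: norm_minus_commute)
  finally show "W1 (proj_law s P) (proj_law s Q) \<le> (SUP t\<in>T. W1 (proj_law t P) (proj_law t Q)) +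
    ennreal \<epsilon> * ((\<integral>\<^sup>+\<omega>. ennreal (norm (X \<omega>)) \<partial>M) + (\<integral>\<^sup>+\<omega>. ennreal (norm (Y \<omega>)) \<partial>M))"
    by (simp add: distrib_left ac_simps)
qed

section \<open>Trigonometric sums and approximation of functions of linear growth\<close>

text \<open>The phase \<open>b\<close> covers the sines, so that these sums are closed under products.\<close>
inductive_set trig :: "('a::euclidean_space \<Rightarrow> real) set" where
  cos: "(\<lambda>x. a * cos (t \<bullet> x + b)) \<in> trig"
| add: "f \<in> trig \<Longrightarrow> g \<in> trig \<Longrightarrow> (\<lambda>x. f x + g x) \<in> trig"

lemma trig_const: "(\<lambda>x. c) \<in> trig"
  using trig.cos[of c 0 0] by simp

text \<open>Product-to-sum formula. Closure under products is what Stone-Weierstrass and composition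
  with polynomials rest on.\<close>

lemma trig_mult:
  fixes f g :: "'a::euclidean_space \<Rightarrow> real"
  assumes "f \<in> trig" "g \<in> trig"
  shows "(\<lambda>x. f x * g x) \<in> trig"
  using assms(1)
proof induction
  case f: (cos a t b)
  show ?case
    using assms(2)
  proof induction
    case (cos a' t' b')
    have "(\<lambda>x. a * cos (t \<bullet> x + b) * (a' * cos (t' \<bullet> x + b'))) =
        (\<lambda>x. (a * a' / 2) * cos ((t - t') \<bullet> x + (b - b')) + (a * a' / 2) * cos ((t + t') \<bullet> x + (b + b')))"
    proof
      fix x
      have e: "(t - t') \<bullet> x + (b - b') = (t \<bullet> x + b) - (t' \<bullet> x + b')"
        "(t + t') \<bullet> x + (b + b') = (t \<bullet> x + b) + (t' \<bullet> x + b')"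
        by (simp_all add: algebra_simps)
      show "a * cos (t \<bullet> x + b) * (a' * cos (t' \<bullet> x + b')) =
        (a * a' / 2) * cos ((t - t') \<bullet> x + (b - b')) + (a * a' / 2) * cos ((t + t') \<bullet> x + (b + b'))"
        unfolding e cos_diff[of "t \<bullet> x + b" "t' \<bullet> x + b'"] cos_add[of "t \<bullet> x + b" "t' \<bullet> x + b'"]
        by (simp add: field_simps)
    qed
    then show ?case by (simp only: trig.intros)
  next
    case (add g h)
    then show ?case using trig.add by (simp only: distrib_left)
  qed
next
  case (add f h)
  then show ?case using trig.add by (simp only: distrib_right)
qed

lemma trig_continuous: "f \<in> trig \<Longrightarrow> continuous_on S f"
  by (induction rule: trig.induct) (auto intro!: continuous_intros)

lemma trig_bounded: "f \<in> trig \<Longrightarrow> \<exists>m. \<forall>x. \<bar>f x\<bar> \<le> m"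
proof (induction rule: trig.induct)
  case (cos a t b)
  show ?case
    by (rule exI[of _ "\<bar>a\<bar>"]) (auto simp: abs_mult mult_left_le)
next
  case (add f g)
  then obtain m n where "\<forall>x. \<bar>f x\<bar> \<le> m" "\<forall>x. \<bar>g x\<bar> \<le> n" by auto
  then show ?case
    by (intro exI[of _ "m + n"]) (meson abs_triangle_ineq add_mono order_trans)
qed

lemma trig_compose_polynomial:
  fixes q :: "real \<Rightarrow> real"
  assumes "real_polynomial_function q" "p \<in> trig"
  shows "(\<lambda>x. q (p x)) \<in> trig"
  using assms(1)
proof induction
  case (linear f)
  then obtain c where "f = (\<lambda>x. x * c)" by (auto simp: real_bounded_linear)
  then show ?case using trig_mult[OF assms(2) trig_const] by simp
qed (auto intro: trig_const trig.add trig_mult)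

lemma trig_separates:
  fixes x y :: "'a::euclidean_space"
  assumes "x \<noteq> y"
  shows "\<exists>f\<in>trig. f x \<noteq> f y"
proof -
  \<comment> \<open>Scaled so that t . (x - y) = 1; the phase - t . y then puts y at angle 0 and x
    at angle 1, where the cosines differ.\<close>
  define t where "t = (1 / (norm (x - y))\<^sup>2) *\<^sub>R (x - y)"
  have "t \<bullet> (x - y) = 1"
    using assms by (simp add: t_def power2_norm_eq_inner)
  then have "t \<bullet> x + - (t \<bullet> y) = 1"
    by (simp add: inner_diff_right)
  moreover have "cos (1::real) \<noteq> 1"
    using cos_monotone_0_pi[of 0 1] pi_gt3 by simp
  ultimately have "1 * cos (t \<bullet> x + - (t \<bullet> y)) \<noteq> 1 * cos (t \<bullet> y + - (t \<bullet> y))"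
    by simp
  then show ?thesis by (intro bexI[OF _ trig.cos])
qed

lemma trig_approx_compact:
  fixes f :: "'a::euclidean_space \<Rightarrow> real"
  assumes "compact S" "continuous_on S f" "e > 0"
  shows "\<exists>g\<in>trig. \<forall>x\<in>S. \<bar>f x - g x\<bar> < e"
proof -
  interpret function_ring_on trig S
    using assms(1) by unfold_locales (auto intro: trig_continuous trig.add trig_mult trig_const trig_separates)
  show ?thesis using assms by (intro Stone_Weierstrass_basic)
qed

text \<open>
  Stone--Weierstrass gives \<open>p\<close> close to \<open>f\<close> on a ball only. Composing \<open>p\<close> with a polynomial close to
  the clamp function on the range of \<open>p\<close> bounds the approximant outside the ball as well.
\<close>
lemma trig_approx_Dd:
  fixes f :: "'a::euclidean_space \<Rightarrow> real"
  assumes f: "continuous_on UNIV f" and C: "\<And>x. \<bar>f x\<bar> \<le> C * max 1 (norm x)"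
    and \<delta>: "\<delta> > 0" and R: "R \<ge> 1"
  shows "\<exists>g\<in>trig. \<forall>x. \<bar>f x - g x\<bar> \<le> \<delta> + 4 * C * max 0 (norm x - R)"
proof -
  have C0: "C \<ge> 0" using C[of 0] by simp
  \<comment> \<open>Radius \<open>2 * R\<close> lets the tail pay for everything outside
    \<open>K\<close>: there \<open>norm x - R\<close> exceeds half of \<open>norm x\<close>, so the
    tail term is at least \<open>2 * C * norm x\<close>, enough for f (at most
    \<open>C * norm x\<close>) plus the clamped value (at most \<open>B = 2 * C * R\<close>). The
    same \<open>B\<close> bounds f on \<open>K\<close>.\<close>
  define K where "K = cball (0::'a) (2 * R)"
  define B where "B = 2 * C * R"
  define clamp where "clamp = (\<lambda>y. max (- B) (min B y))"
  have B0: "B \<ge> 0" using C0 R by (simp add: B_def)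
  obtain p where p: "p \<in> trig" "\<And>x. x \<in> K \<Longrightarrow> \<bar>f x - p x\<bar> < \<delta> / 2"
    using trig_approx_compact[of K f "\<delta> / 2"] \<delta> continuous_on_subset[OF f]
    by (auto simp: K_def)
  obtain m where m: "\<And>x. \<bar>p x\<bar> \<le> m" using trig_bounded[OF p(1)] by auto
  obtain q :: "real \<Rightarrow> real" where q: "real_polynomial_function q" "\<And>y. y \<in> {-m..m} \<Longrightarrow> \<bar>clamp y - q y\<bar> < \<delta> / 2"
  proof (rule Stone_Weierstrass_real_polynomial_function)
    show "continuous_on {-m..m} clamp" unfolding clamp_def by (intro continuous_intros)
    show "0 < \<delta> / 2" using \<delta> by simp
  qed auto
  have qp: "\<bar>clamp (p x) - q (p x)\<bar> < \<delta> / 2" for x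
    using m[of x] by (intro q) auto
  show ?thesis
  proof (intro bexI allI)
    show "(\<lambda>x. q (p x)) \<in> trig" using q(1) p(1) by (rule trig_compose_polynomial)
    fix x
    show "\<bar>f x - q (p x)\<bar> \<le> \<delta> + 4 * C * max 0 (norm x - R)"
    proof (cases "x \<in> K")
      case True
      then have "C * max 1 (norm x) \<le> C * (2 * R)"
        using R C0 by (intro mult_left_mono) (auto simp: K_def)
      then have "\<bar>f x\<bar> \<le> B" using C[of x] by (simp add: B_def)
      \<comment> \<open>The clamp fixes f x and is 1-Lipschitz, so it cannot increase the
        error.\<close>
      then have "\<bar>f x - clamp (p x)\<bar> \<le> \<bar>f x - p x\<bar>" by (auto simp: clamp_def)
      then have "\<bar>f x - q (p x)\<bar> \<le> \<delta>" using p(2)[OF True] qp[of x] by linarith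
      moreover have "0 \<le> 4 * C * max 0 (norm x - R)" using C0 by simp
      ultimately show ?thesis by linarith
    next
      case False
      then have x: "norm x > 2 * R" by (simp add: K_def)
      have "\<bar>clamp (p x)\<bar> \<le> B" using B0 by (auto simp: clamp_def)
      moreover have "\<bar>f x\<bar> \<le> C * norm x" using C[of x] x R by (simp add: max_def split: if_splits)
      moreover have "C * (2 * R) \<le> C * norm x" using x C0 by (intro mult_left_mono) auto
      moreover have "4 * C * max 0 (norm x - R) = 4 * (C * norm x) - 2 * (C * (2 * R))"
        using x R by (simp add: max_def algebra_simps)
      moreover have "C * (2 * R) = B" by (simp add: B_def)
      ultimately show ?thesis using qp[of x] by linarith
    qed
  qed
qed

section \<open>The class \<open>Dd\<close> and transfer of integrability\<close>

lemma DdE: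
  assumes "f \<in> Dd"
  obtains C where "continuous_on UNIV f" "C \<ge> 0" "\<And>x. \<bar>f x\<bar> \<le> C * max 1 (norm x)"
proof -
  obtain C where C: "\<And>x. \<bar>f x\<bar> / max 1 (norm x) \<le> C"
    using assms unfolding Dd_def bdd_above_def by auto
  have "\<bar>f x\<bar> \<le> C * max 1 (norm x)" for x
    using C[of x] by (subst (asm) pos_divide_le_eq) (auto simp: max_def)
  moreover from this[of 0] have "C \<ge> 0" by simp
  ultimately show thesis using that assms by (auto simp: Dd_def)
qed

lemma DdI:
  assumes "continuous_on UNIV f" "\<And>x. \<bar>f x\<bar> \<le> C * max 1 (norm x)"
  shows "f \<in> Dd"
proof -
  have "\<bar>f x\<bar> / max 1 (norm x) \<le> C" for x
    using assms(2)[of x] by (subst pos_divide_le_eq) (auto simp: max_def)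
  then show ?thesis using assms(1) by (auto simp: Dd_def bdd_above_def)
qed

lemma Dd_measurable: "f \<in> Dd \<Longrightarrow> f \<in> borel_measurable borel"
  by (auto simp: Dd_def intro: borel_measurable_continuous_onI)

lemma (in prob_space) integrable_Dd:
  assumes "f \<in> Dd" and [measurable]: "Z \<in> borel_measurable M" and "integrable M (\<lambda>\<omega>. norm (Z \<omega>))"
  shows "integrable M (\<lambda>\<omega>. f (Z \<omega>))"
proof -
  obtain C where C: "continuous_on UNIV f" "C \<ge> 0" "\<And>x. \<bar>f x\<bar> \<le> C * max 1 (norm x)"
    using DdE[OF assms(1)] by blast
  note [measurable] = Dd_measurable[OF assms(1)]
  show ?thesis
  proof (rule Bochner_Integration.integrable_bound)
    show "integrable M (\<lambda>\<omega>. C * (1 + norm (Z \<omega>)))" using assms(3) by simp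
    have "\<bar>f x\<bar> \<le> C * (1 + norm x)" for x
      using C(3)[of x] mult_left_mono[OF _ C(2), of "max 1 (norm x)" "1 + norm x"] by fastforce
    then show "AE \<omega> in M. norm (f (Z \<omega>)) \<le> norm (C * (1 + norm (Z \<omega>)))"
      using C(2) by auto
  qed simp
qed

text \<open>A coupling of finite cost carries a finite first moment from one marginal to the
  other.\<close>

lemma integrable_norm_of_W1:
  fixes P Q :: "'a::euclidean_space measure"
  assumes "W1 P Q < \<infinity>" "integrable P norm"
  shows "integrable Q norm"
proof -
  obtain L where "L \<in> couplings P Q" and fin: "(\<integral>\<^sup>+ z. ennreal (norm (fst z - snd z)) \<partial>L) < \<infinity>"
    using assms(1) unfolding W1_def INF_less_iff by auto
  note L = couplingsD[OF this(1)]
  note [measurable] = L(5,6)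
  have 1: "(\<integral>\<^sup>+ z. ennreal (norm (fst z)) \<partial>L) < \<infinity>"
    using assms(2) unfolding L(3) integrable_iff_bounded by (simp add: nn_integral_distr)
  have "(\<integral>\<^sup>+ z. ennreal (norm (snd z)) \<partial>L) \<le> (\<integral>\<^sup>+ z. ennreal (norm (fst z)) + ennreal (norm (fst z - snd z)) \<partial>L)"
  proof (intro nn_integral_mono)
    fix z :: "'a \<times> 'a"
    have "norm (snd z) \<le> norm (fst z) + norm (fst z - snd z)"
      using norm_triangle_ineq4[of "fst z" "fst z - snd z"] by simp
    then show "ennreal (norm (snd z)) \<le> ennreal (norm (fst z)) + ennreal (norm (fst z - snd z))"
      by (simp flip: ennreal_plus add: ennreal_leI)
  qed
  also have "\<dots> = (\<integral>\<^sup>+ z. ennreal (norm (fst z)) \<partial>L) + (\<integral>\<^sup>+ z. ennreal (norm (fst z - snd z)) \<partial>L)"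
    by (rule nn_integral_add) auto
  also have "\<dots> < \<infinity>" using 1 fin by simp
  finally show ?thesis
    unfolding L(4) integrable_iff_bounded by (simp add: nn_integral_distr)
qed

lemma proj_law_distr:
  assumes [measurable]: "Z \<in> borel_measurable M"
  shows "proj_law t (distr M borel Z) = distr M borel (\<lambda>\<omega>. t \<bullet> Z \<omega>)"
  by (simp add: proj_law_def distr_distr comp_def)

lemma (in prob_space) integrable_inner:
  fixes Z :: "'a \<Rightarrow> 'b::euclidean_space"
  assumes [measurable]: "Z \<in> borel_measurable M" and "integrable M (\<lambda>\<omega>. norm (Z \<omega>))"
  shows "integrable M (\<lambda>\<omega>. t \<bullet> Z \<omega>)"
  using assms by (intro integrable_inner_right) (simp add: integrable_norm_iff)

text \<open>Basis vectors are unit directions, so every coordinate of X inherits a first moment; the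
  l1 norm then dominates the Euclidean one.\<close>

lemma integrable_norm_of_W1_star:
  fixes X Z :: "'b \<Rightarrow> 'a::euclidean_space"
  assumes M: "prob_space M" and [measurable]: "X \<in> borel_measurable M" "Z \<in> borel_measurable M"
    and fin: "W1_star (distr M borel Z) (distr M borel X) < \<infinity>"
    and Z: "integrable M (\<lambda>\<omega>. norm (Z \<omega>))"
  shows "integrable M (\<lambda>\<omega>. norm (X \<omega>))"
proof -
  interpret prob_space M by fact
  have i: "integrable M (\<lambda>\<omega>. \<bar>b \<bullet> X \<omega>\<bar>)" if b: "b \<in> Basis" for b
  proof -
    have "W1 (proj_law b (distr M borel Z)) (proj_law b (distr M borel X)) \<le> W1_star (distr M borel Z) (distr M borel X)"
      unfolding W1_star_def using b by (intro SUP_upper) auto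
    with fin have "W1 (proj_law b (distr M borel Z)) (proj_law b (distr M borel X)) < \<infinity>" by simp
    moreover have "integrable (proj_law b (distr M borel Z)) norm"
      using integrable_inner[OF _ Z, of b] by (simp add: proj_law_distr integrable_distr_eq)
    ultimately have "integrable (proj_law b (distr M borel X)) norm" by (rule integrable_norm_of_W1)
    then show ?thesis by (simp add: proj_law_distr integrable_distr_eq)
  qed
  show ?thesis
  proof (rule Bochner_Integration.integrable_bound)
    show "integrable M (\<lambda>\<omega>. \<Sum>b\<in>Basis. \<bar>b \<bullet> X \<omega>\<bar>)" using i by (intro Bochner_Integration.integrable_sum)
    show "AE \<omega> in M. norm (norm (X \<omega>)) \<le> norm (\<Sum>b\<in>Basis. \<bar>b \<bullet> X \<omega>\<bar>)"
      using norm_le_l1 by (auto simp: inner_commute intro!: order_trans[OF norm_le_l1])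
  qed simp
qed

section \<open>Convergence of expectations from \<open>W1_star\<close>\<close>

text \<open>\<open>W1_star\<close> knows unit directions and duality wants 1-Lipschitz functions, so
  the length of t and the constant l are absorbed into \<open>h\<close> and restored at the end. For
  t = 0 both sides are the constant g 0.\<close>

lemma tendsto_expectation_ridge:
  fixes X :: "'b \<Rightarrow> 'a::euclidean_space" and g :: "real \<Rightarrow> real"
  assumes M: "prob_space M" and [measurable]: "X \<in> borel_measurable M" "\<And>n. Xn n \<in> borel_measurable M"
    and conv: "(\<lambda>n. W1_star (distr M borel (Xn n)) (distr M borel X)) \<longlonglongrightarrow> 0"
    and int: "\<And>n. integrable M (\<lambda>\<omega>. norm (Xn n \<omega>))" "integrable M (\<lambda>\<omega>. norm (X \<omega>))"
    and g: "\<And>x y. \<bar>g x - g y\<bar> \<le> l * \<bar>x - y\<bar>"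
  shows "(\<lambda>n. \<integral>\<omega>. g (t \<bullet> Xn n \<omega>) \<partial>M) \<longlonglongrightarrow> (\<integral>\<omega>. g (t \<bullet> X \<omega>) \<partial>M)"
proof (cases "t = 0")
  case False
  interpret prob_space M by fact
  \<comment> \<open>\<open>l + 1\<close> instead of l keeps the divisor \<open>L\<close> positive
    when l = 0.\<close>
  define c u L where "c = norm t" and "u = t /\<^sub>R norm t" and "L = (l + 1) * c"
  define h where "h = (\<lambda>y. g (c * y) / L)"
  have l: "l \<ge> 0" using g[of 1 0] by simp
  have L: "L > 0" using l False by (simp add: L_def c_def)
  have hlip: "\<bar>h x - h y\<bar> \<le> \<bar>x - y\<bar>" for x y
  proof -
    have "\<bar>g (c * x) - g (c * y)\<bar> \<le> l * \<bar>c * x - c * y\<bar>" by (rule g)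
    also have "\<dots> = (l * c) * \<bar>x - y\<bar>"
      by (simp add: c_def abs_mult flip: right_diff_distrib)
    also have "\<dots> \<le> L * \<bar>x - y\<bar>"
      by (intro mult_right_mono) (auto simp: L_def c_def algebra_simps)
    finally show ?thesis
      using L unfolding h_def diff_divide_distrib[symmetric] abs_divide
      by (simp add: pos_divide_le_eq mult.commute)
  qed
  have "continuous_on UNIV h"
    using hlip by (auto simp: continuous_on_iff dist_real_def intro: order_le_less_trans)
  then have [measurable]: "h \<in> borel_measurable borel" by (rule borel_measurable_continuous_onI)
  have hu: "h (u \<bullet> x) = g (t \<bullet> x) / L" for x
    using False by (simp add: h_def c_def u_def flip: mult.assoc)
  have inth: "integrable M (\<lambda>\<omega>. h (u \<bullet> Z \<omega>))"
    if [measurable]: "Z \<in> borel_measurable M" and "integrable M (\<lambda>\<omega>. norm (Z \<omega>))" for Z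
  proof (rule Bochner_Integration.integrable_bound)
    show "integrable M (\<lambda>\<omega>. \<bar>h 0\<bar> + \<bar>u \<bullet> Z \<omega>\<bar>)"
      using integrable_inner[OF that] by simp
    have "\<bar>h y\<bar> \<le> \<bar>h 0\<bar> + \<bar>y\<bar>" for y using hlip[of y 0] by simp
    then show "AE \<omega> in M. norm (h (u \<bullet> Z \<omega>)) \<le> norm (\<bar>h 0\<bar> + \<bar>u \<bullet> Z \<omega>\<bar>)" by auto
  qed simp
  have bound: "ennreal \<bar>(\<integral>\<omega>. h (u \<bullet> Xn n \<omega>) \<partial>M) - (\<integral>\<omega>. h (u \<bullet> X \<omega>) \<partial>M)\<bar>
      \<le> W1_star (distr M borel (Xn n)) (distr M borel X)" for n
  proof -
    have "ennreal \<bar>(\<integral>\<omega>. h (u \<bullet> Xn n \<omega>) \<partial>M) - (\<integral>\<omega>. h (u \<bullet> X \<omega>) \<partial>M)\<bar>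
        \<le> W1 (proj_law u (distr M borel (Xn n))) (proj_law u (distr M borel X))"
      using expectation_diff_le_W1[of "proj_law u (distr M borel (Xn n))" h "proj_law u (distr M borel X)"] hlip
        inth[of X] inth[of "Xn n"] int
      by (simp add: proj_law_distr integrable_distr_eq integral_distr)
    also have "\<dots> \<le> W1_star (distr M borel (Xn n)) (distr M borel X)"
      unfolding W1_star_def using False by (intro SUP_upper) (auto simp: u_def)
    finally show ?thesis .
  qed
  have "(\<lambda>n. ennreal \<bar>(\<integral>\<omega>. h (u \<bullet> Xn n \<omega>) \<partial>M) - (\<integral>\<omega>. h (u \<bullet> X \<omega>) \<partial>M)\<bar>) \<longlonglongrightarrow> ennreal 0"
    unfolding ennreal_0
    by (rule tendsto_sandwich[OF _ _ tendsto_const conv]) (auto intro!: always_eventually bound)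
  then have "(\<lambda>n. \<bar>(\<integral>\<omega>. h (u \<bullet> Xn n \<omega>) \<partial>M) - (\<integral>\<omega>. h (u \<bullet> X \<omega>) \<partial>M)\<bar>) \<longlonglongrightarrow> 0"
    by (subst (asm) tendsto_ennreal_iff) auto
  then have "(\<lambda>n. (\<integral>\<omega>. h (u \<bullet> Xn n \<omega>) \<partial>M)) \<longlonglongrightarrow> (\<integral>\<omega>. h (u \<bullet> X \<omega>) \<partial>M)"
    by (simp add: tendsto_rabs_zero_iff LIM_zero_iff)
  then have "(\<lambda>n. L * (\<integral>\<omega>. h (u \<bullet> Xn n \<omega>) \<partial>M)) \<longlonglongrightarrow> L * (\<integral>\<omega>. h (u \<bullet> X \<omega>) \<partial>M)"
    by (intro tendsto_intros)
  then show ?thesis using L by (simp add: hu)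
qed simp

text \<open>f is within \<eta>/8 plus a tail of a trigonometric sum. Sum and tail both have
  convergent expectations, so the tail of \<open>Xn\<close> is eventually as small as the chosen
  tail of X.\<close>

lemma tendsto_expectation_Dd:
  fixes X :: "'b \<Rightarrow> 'a::euclidean_space"
  assumes M: "prob_space M" and X[measurable]: "X \<in> borel_measurable M" and Xn[measurable]: "\<And>n. Xn n \<in> borel_measurable M"
    and conv: "(\<lambda>n. W1_star (distr M borel (Xn n)) (distr M borel X)) \<longlonglongrightarrow> 0"
    and int: "\<And>n. integrable M (\<lambda>\<omega>. norm (Xn n \<omega>))" "integrable M (\<lambda>\<omega>. norm (X \<omega>))"
    and f: "f \<in> Dd"
  shows "(\<lambda>n. \<integral>\<omega>. f (Xn n \<omega>) \<partial>M) \<longlonglongrightarrow> (\<integral>\<omega>. f (X \<omega>) \<partial>M)"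
proof (rule LIMSEQ_I)
  interpret prob_space M by fact
  note ridge = tendsto_expectation_ridge[OF M X Xn conv int]
  obtain C where C: "continuous_on UNIV f" "C \<ge> 0" "\<And>x. \<bar>f x\<bar> \<le> C * max 1 (norm x)"
    using DdE[OF f] by blast
  fix \<eta> :: real assume \<eta>: "0 < \<eta>"
  \<comment> \<open>The threshold k is shared equally among the coordinates: by
    \<open>norm_le_l1\<close> the sum still dominates \<open>max 0 (norm x - k)\<close>, and each
    summand is a 1-Lipschitz ridge function.\<close>
  define H :: "nat \<Rightarrow> 'a \<Rightarrow> real"
    where "H = (\<lambda>k x. \<Sum>b\<in>Basis. max 0 (\<bar>b \<bullet> x\<bar> - real k / DIM('a)))"
  have H0: "H k x \<ge> 0" for k x by (auto simp: H_def intro!: sum_nonneg)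
  have H_norm: "max 0 (norm x - real k) \<le> H k x" for k x
  proof -
    have "norm x - real k \<le> (\<Sum>b\<in>Basis. \<bar>b \<bullet> x\<bar>) - real k"
      using norm_le_l1[of x] by (simp add: inner_commute)
    also have "\<dots> = (\<Sum>b\<in>Basis. \<bar>b \<bullet> x\<bar> - real k / DIM('a))"
      by (simp add: sum_subtractf)
    also have "\<dots> \<le> H k x" unfolding H_def by (intro sum_mono) auto
    finally show ?thesis using H0 by simp
  qed
  have int_h: "integrable M (\<lambda>\<omega>. max 0 (\<bar>b \<bullet> Z \<omega>\<bar> - r))"
    if [measurable]: "Z \<in> borel_measurable M" and "integrable M (\<lambda>\<omega>. norm (Z \<omega>))" for Z :: "'b \<Rightarrow> 'a" and b r
    using integrable_inner[OF that, of b] by (intro integrable_max) auto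
  have int_H: "integrable M (\<lambda>\<omega>. H k (Z \<omega>))"
    if "Z \<in> borel_measurable M" and "integrable M (\<lambda>\<omega>. norm (Z \<omega>))" for Z k
    unfolding H_def using int_h[OF that] by (intro Bochner_Integration.integrable_sum)
  have H_lim: "(\<lambda>n. \<integral>\<omega>. H k (Xn n \<omega>) \<partial>M) \<longlonglongrightarrow> (\<integral>\<omega>. H k (X \<omega>) \<partial>M)" for k
    unfolding H_def using int_h[OF X int(2)] int_h[OF Xn int(1)]
    by (simp add: Bochner_Integration.integral_sum)
       (intro tendsto_sum ridge[where l = 1 and g = "\<lambda>y. max 0 (\<bar>y\<bar> - real k / DIM('a))"], auto)
  have H_tail: "(\<lambda>k. \<integral>\<omega>. H k (X \<omega>) \<partial>M) \<longlonglongrightarrow> (\<integral>\<omega>. 0 \<partial>M)"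
  proof (rule integral_dominated_convergence)
    show "integrable M (\<lambda>\<omega>. H 0 (X \<omega>))" by (rule int_H) (use int in auto)
    show "AE \<omega> in M. (\<lambda>k. H k (X \<omega>)) \<longlonglongrightarrow> 0"
    proof (intro AE_I2 tendsto_null_sum[of Basis, folded H_def] | unfold H_def)+
      fix \<omega> and b :: 'a
      show "(\<lambda>k. max 0 (\<bar>b \<bullet> X \<omega>\<bar> - real k / DIM('a))) \<longlonglongrightarrow> 0"
      proof (rule tendsto_eventually, rule eventually_sequentiallyI)
        fix k assume "nat \<lceil>\<bar>b \<bullet> X \<omega>\<bar> * DIM('a)\<rceil> \<le> k"
        then have "\<bar>b \<bullet> X \<omega>\<bar> * DIM('a) \<le> real k" by linarith
        then show "max 0 (\<bar>b \<bullet> X \<omega>\<bar> - real k / DIM('a)) = 0"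
          by (simp add: max_def field_simps)
      qed
    qed
    show "AE \<omega> in M. norm (H k (X \<omega>)) \<le> H 0 (X \<omega>)" for k
      using H0 by (intro AE_I2) (auto simp: H_def intro!: sum_mono)
  qed (auto simp: H_def)
  \<comment> \<open>k >= 1 because \<open>trig_approx_Dd\<close> asks for a radius of at least
    1.\<close>
  obtain k where k: "k \<ge> 1" "4 * C * (\<integral>\<omega>. H k (X \<omega>) \<partial>M) < \<eta> / 8"
  proof -
    have "(\<lambda>k. 4 * C * (\<integral>\<omega>. H k (X \<omega>) \<partial>M)) \<longlonglongrightarrow> 4 * C * (\<integral>\<omega>. 0 \<partial>M)"
      by (intro tendsto_intros H_tail)
    then have "\<forall>\<^sub>F k in sequentially. 4 * C * (\<integral>\<omega>. H k (X \<omega>) \<partial>M) < \<eta> / 8"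
      using \<eta> by (intro order_tendstoD(2)) auto
    then have "\<forall>\<^sub>F k in sequentially. k \<ge> 1 \<and> 4 * C * (\<integral>\<omega>. H k (X \<omega>) \<partial>M) < \<eta> / 8"
      using eventually_ge_at_top[of 1] by eventually_elim auto
    then show thesis using that by (auto dest: eventually_happens)
  qed
  obtain a where a: "a \<in> trig" "\<And>x. \<bar>f x - a x\<bar> \<le> \<eta> / 8 + 4 * C * max 0 (norm x - real k)"
    using trig_approx_Dd[OF C(1) C(3), of "\<eta> / 8" "real k"] \<eta> k(1) by auto
  have fa: "\<bar>f x - a x\<bar> \<le> \<eta> / 8 + 4 * C * H k x" for x
    using a(2)[of x] mult_left_mono[OF H_norm[of x k], of "4 * C"] C(2) by linarith
  have trig_int: "integrable M (\<lambda>\<omega>. g (Z \<omega>))" if g: "g \<in> trig" and [measurable]: "Z \<in> borel_measurable M" for g and Z :: "'b \<Rightarrow> 'a"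
  proof -
    have [measurable]: "g \<in> borel_measurable borel"
      using trig_continuous[OF g] by (rule borel_measurable_continuous_onI)
    obtain m where "\<And>x. \<bar>g x\<bar> \<le> m" using trig_bounded[OF g] by auto
    then show ?thesis by (intro integrable_const_bound[of _ m]) auto
  qed
  have trig_lim: "(\<lambda>n. \<integral>\<omega>. g (Xn n \<omega>) \<partial>M) \<longlonglongrightarrow> (\<integral>\<omega>. g (X \<omega>) \<partial>M)" if "g \<in> trig" for g
    using that
  proof induction
    case (cos c t b)
    show ?case
    proof (rule ridge[where g = "\<lambda>y. c * cos (y + b)" and l = "\<bar>c\<bar>"])
      fix x y :: real
      have "\<bar>cos (x + b) - cos (y + b)\<bar> \<le> \<bar>x - y\<bar>"
      proof -
        have "norm (cos (x + b) - cos (y + b)) \<le> 1 * norm ((x + b) - (y + b))"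
        proof (rule field_differentiable_bound[of UNIV])
          show "(cos has_field_derivative - sin z) (at z within UNIV)" for z :: real
            by (rule DERIV_cos)
        qed auto
        then show ?thesis by simp
      qed
      then show "\<bar>c * cos (x + b) - c * cos (y + b)\<bar> \<le> \<bar>c\<bar> * \<bar>x - y\<bar>"
        by (simp add: abs_mult mult_left_mono flip: right_diff_distrib)
    qed
  next
    case (add f g)
    then show ?case by (simp add: trig_int tendsto_add)
  qed
  have approx: "\<bar>(\<integral>\<omega>. f (Z \<omega>) \<partial>M) - (\<integral>\<omega>. a (Z \<omega>) \<partial>M)\<bar> \<le> \<eta> / 8 + 4 * C * (\<integral>\<omega>. H k (Z \<omega>) \<partial>M)"
    if [measurable]: "Z \<in> borel_measurable M" and Z: "integrable M (\<lambda>\<omega>. norm (Z \<omega>))" for Z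
  proof -
    note i = integrable_Dd[OF f that] trig_int[OF a(1) that(1)] int_H[OF that]
    have "\<bar>(\<integral>\<omega>. f (Z \<omega>) \<partial>M) - (\<integral>\<omega>. a (Z \<omega>) \<partial>M)\<bar> = \<bar>\<integral>\<omega>. f (Z \<omega>) - a (Z \<omega>) \<partial>M\<bar>"
      using i by simp
    also have "\<dots> \<le> (\<integral>\<omega>. \<bar>f (Z \<omega>) - a (Z \<omega>)\<bar> \<partial>M)"
      by (rule integral_abs_bound)
    also have "\<dots> \<le> (\<integral>\<omega>. \<eta> / 8 + 4 * C * H k (Z \<omega>) \<partial>M)"
      using i fa by (intro integral_mono) auto
    also have "\<dots> = \<eta> / 8 + 4 * C * (\<integral>\<omega>. H k (Z \<omega>) \<partial>M)"
      using i by (simp add: prob_space)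
    finally show ?thesis .
  qed
  \<comment> \<open>The error budget: for X and for \<open>Xn n\<close> an approximation error
    \<eta>/8 and a tail below \<eta>/8 each, and \<eta>/8 between the two trigonometric
    expectations, in total 5\<eta>/8.\<close>
  have "(\<lambda>n. 4 * C * (\<integral>\<omega>. H k (Xn n \<omega>) \<partial>M)) \<longlonglongrightarrow> 4 * C * (\<integral>\<omega>. H k (X \<omega>) \<partial>M)"
    by (intro tendsto_intros H_lim)
  then have "\<forall>\<^sub>F n in sequentially. 4 * C * (\<integral>\<omega>. H k (Xn n \<omega>) \<partial>M) < \<eta> / 8"
    using k(2) by (rule order_tendstoD(2))
  moreover have "\<forall>\<^sub>F n in sequentially. dist (\<integral>\<omega>. a (Xn n \<omega>) \<partial>M) (\<integral>\<omega>. a (X \<omega>) \<partial>M) < \<eta> / 8"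
    using \<eta> by (intro tendstoD trig_lim a) auto
  ultimately have "\<forall>\<^sub>F n in sequentially. norm ((\<integral>\<omega>. f (Xn n \<omega>) \<partial>M) - (\<integral>\<omega>. f (X \<omega>) \<partial>M)) < \<eta>"
  proof eventually_elim
    case (elim n)
    then show ?case
      using approx[OF X int(2)] approx[OF Xn int(1), of n] k(2) \<eta>
      unfolding dist_real_def real_norm_def by linarith
  qed
  then show "\<exists>no. \<forall>n\<ge>no. norm ((\<integral>\<omega>. f (Xn n \<omega>) \<partial>M) - (\<integral>\<omega>. f (X \<omega>) \<partial>M)) < \<eta>"
    by (simp add: eventually_sequentially)
qed

section \<open>Coupling along a partition\<close>

text \<open>A density with unit integral in each variable has marginals P and Q. Almost everywhere
  is all that can be asked: the density used below meets the condition only off a null set when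
  nothing is left over.\<close>

lemma W1_density_le:
  fixes P Q :: "'a::euclidean_space measure" and h :: "'a \<Rightarrow> 'a \<Rightarrow> real"
  assumes P: "prob_space P" "sets P = sets borel" and Q: "prob_space Q" "sets Q = sets borel"
    and [measurable]: "case_prod h \<in> borel_measurable (P \<Otimes>\<^sub>M Q)"
    and hP: "AE x in P. (\<integral>\<^sup>+y. ennreal (h x y) \<partial>Q) = 1"
    and hQ: "AE y in Q. (\<integral>\<^sup>+x. ennreal (h x y) \<partial>P) = 1"
  shows "W1 P Q \<le> (\<integral>\<^sup>+x. \<integral>\<^sup>+y. ennreal (h x y) * ennreal (norm (x - y)) \<partial>Q \<partial>P)"
proof -
  interpret P: prob_space P by fact
  interpret Q: prob_space Q by fact
  interpret pair_sigma_finite P Q ..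
  note [measurable_cong] = P(2) Q(2)
  let ?N = "density (P \<Otimes>\<^sub>M Q) (\<lambda>(x, y). ennreal (h x y))"
  have 1: "distr ?N borel fst = P"
  proof (rule measure_eqI)
    fix A assume "A \<in> sets (distr ?N borel fst)"
    then have A [measurable]: "A \<in> sets borel" by simp
    have "emeasure (distr ?N borel fst) A = emeasure ?N (fst -` A \<inter> space ?N)"
      by (rule emeasure_distr) measurable
    also have "\<dots> = (\<integral>\<^sup>+z. ennreal (h (fst z) (snd z)) * indicator A (fst z) \<partial>(P \<Otimes>\<^sub>M Q))"
      by (subst emeasure_density) (auto intro!: nn_integral_cong simp: case_prod_beta split: split_indicator)
    also have "\<dots> = (\<integral>\<^sup>+x. \<integral>\<^sup>+y. ennreal (h x y) * indicator A x \<partial>Q \<partial>P)"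
      by (subst Q.nn_integral_fst[symmetric]) auto
    also have "\<dots> = (\<integral>\<^sup>+x. (\<integral>\<^sup>+y. ennreal (h x y) \<partial>Q) * indicator A x \<partial>P)"
      by (intro nn_integral_cong nn_integral_multc) measurable
    also have "\<dots> = (\<integral>\<^sup>+x. indicator A x \<partial>P)"
      using hP by (intro nn_integral_cong_AE) auto
    finally show "emeasure (distr ?N borel fst) A = emeasure P A" by simp
  qed (simp add: P)
  have 2: "distr ?N borel snd = Q"
  proof (rule measure_eqI)
    fix A assume "A \<in> sets (distr ?N borel snd)"
    then have A [measurable]: "A \<in> sets borel" by simp
    have "emeasure (distr ?N borel snd) A = emeasure ?N (snd -` A \<inter> space ?N)"
      by (rule emeasure_distr) measurable
    also have "\<dots> = (\<integral>\<^sup>+z. ennreal (h (fst z) (snd z)) * indicator A (snd z) \<partial>(P \<Otimes>\<^sub>M Q))"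
      by (subst emeasure_density) (auto intro!: nn_integral_cong simp: case_prod_beta split: split_indicator)
    also have "\<dots> = (\<integral>\<^sup>+y. \<integral>\<^sup>+x. ennreal (h x y) * indicator A y \<partial>P \<partial>Q)"
      by (subst nn_integral_snd[symmetric]) auto
    also have "\<dots> = (\<integral>\<^sup>+y. (\<integral>\<^sup>+x. ennreal (h x y) \<partial>P) * indicator A y \<partial>Q)"
      by (intro nn_integral_cong nn_integral_multc) measurable
    also have "\<dots> = (\<integral>\<^sup>+y. indicator A y \<partial>Q)"
      using hQ by (intro nn_integral_cong_AE) auto
    finally show "emeasure (distr ?N borel snd) A = emeasure Q A" by simp
  qed (simp add: Q)
  have N: "prob_space ?N"
  proof (rule prob_spaceI)
    have "emeasure ?N (space ?N) = (\<integral>\<^sup>+x. \<integral>\<^sup>+y. ennreal (h x y) \<partial>Q \<partial>P)"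
      by (simp add: emeasure_density Q.nn_integral_fst[symmetric] case_prod_beta cong: nn_integral_cong)
    also have "\<dots> = (\<integral>\<^sup>+x. 1 \<partial>P)" using hP by (intro nn_integral_cong_AE) auto
    finally show "emeasure ?N (space ?N) = 1" by (simp add: P.emeasure_space_1)
  qed
  have "W1 (distr ?N borel fst) (distr ?N borel snd) \<le> (\<integral>\<^sup>+ w. ennreal (norm (fst w - snd w)) \<partial>?N)"
    by (rule W1_distr_le[OF N]) measurable
  also have "\<dots> = (\<integral>\<^sup>+x. \<integral>\<^sup>+y. ennreal (h x y) * ennreal (norm (x - y)) \<partial>Q \<partial>P)"
    by (subst nn_integral_density) (auto simp: Q.nn_integral_fst[symmetric] case_prod_beta)
  finally show ?thesis unfolding 1 2 .
qed

text \<open>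
  The coupling has density \<open>h\<close> with respect to \<open>P \<Otimes> Q\<close>. Division by zero is harmless: if \<open>p i\<close> or
  \<open>q i\<close> vanishes then so does \<open>m i\<close>, and if \<open>\<mu> = 0\<close> then \<open>a\<close> and \<open>b\<close> vanish almost everywhere.
\<close>
lemma W1_le_partition:
  fixes P Q :: "'a::euclidean_space measure" and \<phi> :: "'i \<Rightarrow> 'a \<Rightarrow> real"
  assumes P: "prob_space P" "sets P = sets borel" and Q: "prob_space Q" "sets Q = sets borel"
    and int: "integrable P norm" "integrable Q norm"
    and I: "finite I"
    and meas [measurable]: "\<And>i. i \<in> I \<Longrightarrow> \<phi> i \<in> borel_measurable borel"
    and nonneg: "\<And>i x. i \<in> I \<Longrightarrow> 0 \<le> \<phi> i x" and le1: "\<And>x. (\<Sum>i\<in>I. \<phi> i x) \<le> 1"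
    and B: "\<And>i x. i \<in> I \<Longrightarrow> \<phi> i x \<noteq> 0 \<Longrightarrow> norm x \<le> B"
    and \<delta>: "\<And>i x y. i \<in> I \<Longrightarrow> \<phi> i x \<noteq> 0 \<Longrightarrow> \<phi> i y \<noteq> 0 \<Longrightarrow> norm (x - y) \<le> \<delta>" "\<delta> \<ge> 0"
  defines "s \<equiv> \<lambda>x. 1 - (\<Sum>i\<in>I. \<phi> i x)"
  shows "W1 P Q \<le> ennreal (\<delta> + (\<integral>x. s x * norm x \<partial>P) + (\<integral>x. s x * norm x \<partial>Q)
    + B * (\<Sum>i\<in>I. \<bar>(\<integral>x. \<phi> i x \<partial>P) - (\<integral>x. \<phi> i x \<partial>Q)\<bar>))"
proof -
  interpret P: prob_space P by fact
  interpret Q: prob_space Q by fact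
  interpret pair_sigma_finite P Q ..
  note [measurable_cong] = P(2) Q(2)
  \<comment> \<open>\<open>p i\<close>, \<open>q i\<close> are the masses of cell i,
    \<open>m i\<close> the mass that can stay in it, \<mu> the remaining mass, \<open>a\<close> and
    \<open>b\<close> the leftover densities with respect to P and Q. In \<open>h\<close>, cell i
    carries the product of the two normalized cell laws with mass \<open>m i\<close>; dividing by
    \<mu> gives the product of the leftovers mass \<mu>.\<close>
  define p where "p = (\<lambda>i. \<integral>x. \<phi> i x \<partial>P)"
  define q where "q = (\<lambda>i. \<integral>x. \<phi> i x \<partial>Q)"
  define m where "m = (\<lambda>i. min (p i) (q i))"
  define \<mu> where "\<mu> = 1 - (\<Sum>i\<in>I. m i)"
  define a where "a = (\<lambda>x. 1 - (\<Sum>i\<in>I. m i / p i * \<phi> i x))"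
  define b where "b = (\<lambda>x. 1 - (\<Sum>i\<in>I. m i / q i * \<phi> i x))"
  define h where "h = (\<lambda>x y. (\<Sum>i\<in>I. m i / (p i * q i) * (\<phi> i x * \<phi> i y)) + a x * b y / \<mu>)"
  have \<phi>1: "\<phi> i x \<le> 1" if "i \<in> I" for i x
    using member_le_sum[OF that, of "\<lambda>i. \<phi> i x"] nonneg I le1[of x] by fastforce
  have p0: "0 \<le> p i" "0 \<le> q i" if "i \<in> I" for i
    using nonneg[OF that] by (auto simp: p_def q_def)
  have m0: "0 \<le> m i" "m i \<le> p i" "m i \<le> q i" if "i \<in> I" for i using p0[OF that] by (auto simp: m_def)
  have mp: "m i / p i * p i = m i" "m i / q i * q i = m i" "m i / (p i * q i) * q i = m i / p i"
    "m i / (p i * q i) * p i = m i / q i" "0 \<le> m i / p i" "0 \<le> m i / q i" "m i / p i \<le> 1" "m i / q i \<le> 1"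
    "0 \<le> m i / (p i * q i)"
    if "i \<in> I" for i
    using m0[OF that] p0[OF that] by (auto simp: divide_le_eq_1)
  have int_\<phi>: "integrable P (\<phi> i)" "integrable Q (\<phi> i)" if "i \<in> I" for i
    using that \<phi>1 nonneg by (auto intro!: P.integrable_const_bound[of _ 1] Q.integrable_const_bound[of _ 1])
  have int_\<phi>n: "integrable P (\<lambda>x. \<phi> i x * norm x)" "integrable Q (\<lambda>x. \<phi> i x * norm x)" if "i \<in> I" for i
    using that \<phi>1[OF that] nonneg[OF that]
    by (auto intro!: Bochner_Integration.integrable_bound[OF int(1)] Bochner_Integration.integrable_bound[OF int(2)] AE_I2
        simp: mult_left_le_one_le abs_mult)
  have a_meas [measurable]: "a \<in> borel_measurable borel" "b \<in> borel_measurable borel"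
    unfolding a_def b_def by measurable
  have s0: "0 \<le> s x" for x using le1 by (simp add: s_def)
  \<comment> \<open>The leftover is what lies outside all cells plus the unmatched fraction of each
    cell. This form shows nonnegativity and later bounds the cost.\<close>
  have a_eq: "a x = s x + (\<Sum>i\<in>I. (1 - m i / p i) * \<phi> i x)"
    and b_eq: "b x = s x + (\<Sum>i\<in>I. (1 - m i / q i) * \<phi> i x)" for x
    by (simp_all add: a_def b_def s_def sum_subtractf left_diff_distrib)
  have a0: "0 \<le> a x" "0 \<le> b x" for x
    unfolding a_eq b_eq using mp nonneg s0 by (auto intro!: add_nonneg_nonneg sum_nonneg mult_nonneg_nonneg)
  have int_a: "integrable P a" "integrable Q b"
    unfolding a_def b_def using int_\<phi> by auto
  have int_an: "integrable P (\<lambda>x. a x * norm x)" "integrable Q (\<lambda>x. b x * norm x)"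
    unfolding a_def b_def left_diff_distrib sum_distrib_right
    using int int_\<phi>n by (auto simp: mult.assoc)
  have intg_a: "(\<integral>x. a x \<partial>P) = \<mu>" "(\<integral>x. b x \<partial>Q) = \<mu>"
  proof -
    have "(\<integral>x. a x \<partial>P) = 1 - (\<Sum>i\<in>I. m i / p i * p i)" "(\<integral>x. b x \<partial>Q) = 1 - (\<Sum>i\<in>I. m i / q i * q i)"
      unfolding a_def b_def using int_\<phi> by (simp_all add: P.prob_space Q.prob_space p_def q_def)
    then show "(\<integral>x. a x \<partial>P) = \<mu>" "(\<integral>x. b x \<partial>Q) = \<mu>"
      by (simp_all only: mp \<mu>_def cong: sum.cong)
  qed
  have \<mu>0: "0 \<le> \<mu>" unfolding intg_a(1)[symmetric] using a0 by simp
  have h0: "0 \<le> h x y" for x y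
    unfolding h_def
    by (intro add_nonneg_nonneg sum_nonneg mult_nonneg_nonneg divide_nonneg_nonneg[OF _ \<mu>0] mp(9) nonneg a0)
  have hP: "AE x in P. (\<integral>\<^sup>+y. ennreal (h x y) \<partial>Q) = 1"
  proof -
    have "AE x in P. \<mu> = 0 \<longrightarrow> a x = 0"
      using integral_nonneg_eq_0_iff_AE[OF int_a(1)] a0 intg_a by auto
    then show ?thesis
    proof (rule AE_mp, intro AE_I2 impI)
      fix x assume *: "\<mu> = 0 \<longrightarrow> a x = 0"
      have i: "integrable Q (h x)" unfolding h_def using int_\<phi> int_a by auto
      have "(\<integral>y. h x y \<partial>Q) = (\<Sum>i\<in>I. m i / (p i * q i) * (\<phi> i x * q i)) + a x * \<mu> / \<mu>"
        unfolding h_def using int_\<phi> int_a by (simp add: q_def intg_a)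
      also have "(\<Sum>i\<in>I. m i / (p i * q i) * (\<phi> i x * q i)) = (\<Sum>i\<in>I. (m i / (p i * q i) * q i) * \<phi> i x)"
        by (intro sum.cong refl) (simp only: mult_ac)
      also have "\<dots> = (\<Sum>i\<in>I. m i / p i * \<phi> i x)"
        by (intro sum.cong refl) (simp only: mp)
      also have "\<dots> + a x * \<mu> / \<mu> = 1" using * by (auto simp: a_def)
      finally show "(\<integral>\<^sup>+y. ennreal (h x y) \<partial>Q) = 1"
        using nn_integral_eq_integral[OF i] h0 by simp
    qed
  qed
  have hQ: "AE y in Q. (\<integral>\<^sup>+x. ennreal (h x y) \<partial>P) = 1"
  proof -
    have "AE x in Q. \<mu> = 0 \<longrightarrow> b x = 0"
      using integral_nonneg_eq_0_iff_AE[OF int_a(2)] a0 intg_a by auto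
    then show ?thesis
    proof (rule AE_mp, intro AE_I2 impI)
      fix y assume *: "\<mu> = 0 \<longrightarrow> b y = 0"
      have i: "integrable P (\<lambda>x. h x y)" unfolding h_def using int_\<phi> int_a by auto
      have "(\<integral>x. h x y \<partial>P) = (\<Sum>i\<in>I. m i / (p i * q i) * (p i * \<phi> i y)) + \<mu> * b y / \<mu>"
        unfolding h_def using int_\<phi> int_a by (simp add: p_def intg_a)
      also have "(\<Sum>i\<in>I. m i / (p i * q i) * (p i * \<phi> i y)) = (\<Sum>i\<in>I. (m i / (p i * q i) * p i) * \<phi> i y)"
        by (intro sum.cong refl) (simp only: mult_ac)
      also have "\<dots> = (\<Sum>i\<in>I. m i / q i * \<phi> i y)"
        by (intro sum.cong refl) (simp only: mp)
      also have "\<dots> + \<mu> * b y / \<mu> = 1" using * by (auto simp: b_def)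
      finally show "(\<integral>\<^sup>+x. ennreal (h x y) \<partial>P) = 1"
        using nn_integral_eq_integral[OF i] h0 by simp
    qed
  qed
  have meas_h: "case_prod h \<in> borel_measurable (P \<Otimes>\<^sub>M Q)"
    unfolding h_def by measurable
  define an bn where "an = (\<integral>x. a x * norm x \<partial>P)" and "bn = (\<integral>x. b x * norm x \<partial>Q)"
  have an0: "0 \<le> an" "0 \<le> bn" using a0 by (auto simp: an_def bn_def)
  \<comment> \<open>Majorant of the cost: \<delta> inside a cell, \<open>norm x + norm y\<close> on
    leftovers. Its x and y parts separate, so it integrates explicitly.\<close>
  define k where "k = (\<lambda>x y. (\<Sum>i\<in>I. m i / (p i * q i) * (\<phi> i x * \<phi> i y)) * \<delta>
      + (a x * norm x * b y + a x * (b y * norm y)) / \<mu>)"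
  have hk: "h x y * norm (x - y) \<le> k x y" for x y
  proof -
    have "(\<Sum>i\<in>I. m i / (p i * q i) * (\<phi> i x * \<phi> i y)) * norm (x - y) \<le> (\<Sum>i\<in>I. m i / (p i * q i) * (\<phi> i x * \<phi> i y)) * \<delta>"
      unfolding sum_distrib_right
    proof (rule sum_mono)
      fix i assume i: "i \<in> I"
      show "m i / (p i * q i) * (\<phi> i x * \<phi> i y) * norm (x - y) \<le> m i / (p i * q i) * (\<phi> i x * \<phi> i y) * \<delta>"
      proof (cases "\<phi> i x * \<phi> i y = 0")
        case False
        then show ?thesis
          by (intro mult_left_mono mult_nonneg_nonneg mp(9) nonneg i \<delta>(1)[OF i]) auto
      next
        case True
        then show ?thesis by (simp only: mult_zero_right mult_zero_left order_refl)
      qed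
    qed
    moreover have "a x * b y / \<mu> * norm (x - y) \<le> a x * b y / \<mu> * (norm x + norm y)"
      using a0 \<mu>0 by (intro mult_left_mono norm_triangle_ineq4) auto
    ultimately show ?thesis
      by (simp add: h_def k_def distrib_right distrib_left add_divide_distrib ac_simps)
  qed
  have k0: "0 \<le> k x y" for x y using hk[of x y] h0[of x y] by (meson mult_nonneg_nonneg norm_ge_zero order_trans)
  define K where "K = (\<lambda>x. (\<Sum>i\<in>I. m i / p i * \<phi> i x) * \<delta> + (a x * norm x * \<mu> + a x * bn) / \<mu>)"
  have k_int: "(\<integral>\<^sup>+y. ennreal (k x y) \<partial>Q) = ennreal (K x)" for x
  proof -
    have i: "integrable Q (k x)" unfolding k_def using int_\<phi> int_a int_an by auto
    have "(\<integral>y. k x y \<partial>Q) = (\<Sum>i\<in>I. m i / (p i * q i) * (\<phi> i x * q i)) * \<delta> + (a x * norm x * \<mu> + a x * bn) / \<mu>"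
      unfolding k_def using int_\<phi> int_a int_an by (simp add: q_def intg_a bn_def)
    also have "(\<Sum>i\<in>I. m i / (p i * q i) * (\<phi> i x * q i)) = (\<Sum>i\<in>I. (m i / (p i * q i) * q i) * \<phi> i x)"
      by (intro sum.cong refl) (simp only: mult_ac)
    also have "\<dots> = (\<Sum>i\<in>I. m i / p i * \<phi> i x)"
      by (intro sum.cong refl) (simp only: mp)
    finally show ?thesis
      using nn_integral_eq_integral[OF i] k0 by (simp add: K_def)
  qed
  have K0: "0 \<le> K x" for x
    unfolding K_def
    by (intro add_nonneg_nonneg mult_nonneg_nonneg sum_nonneg divide_nonneg_nonneg[OF _ \<mu>0]
        mp(5) nonneg a0 \<mu>0 \<delta>(2) an0 norm_ge_zero)
  have K_int: "(\<integral>\<^sup>+x. ennreal (K x) \<partial>P) \<le> ennreal (\<delta> + an + bn)"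
  proof -
    have i: "integrable P K" unfolding K_def using int_\<phi> int_a int_an by auto
    have "(\<integral>x. K x \<partial>P) = (\<Sum>i\<in>I. m i / p i * p i) * \<delta> + (an * \<mu> + \<mu> * bn) / \<mu>"
      unfolding K_def using int_\<phi> int_a int_an by (simp add: p_def intg_a an_def)
    also have "(\<Sum>i\<in>I. m i / p i * p i) = (\<Sum>i\<in>I. m i)"
      by (intro sum.cong refl mp)
    also have "\<dots> = 1 - \<mu>" by (simp add: \<mu>_def)
    \<comment> \<open>Only an inequality: for \<mu> = 0 the quotient is 0 rather than
      \<open>an + bn\<close>.\<close>
    also have "(1 - \<mu>) * \<delta> + (an * \<mu> + \<mu> * bn) / \<mu> \<le> \<delta> + an + bn"
    proof -
      have "(an * \<mu> + \<mu> * bn) / \<mu> \<le> an + bn"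
        using an0 by (cases "\<mu> = 0") (auto simp: add_divide_distrib)
      moreover have "0 \<le> \<mu> * \<delta>" using \<mu>0 \<delta>(2) by simp
      ultimately show ?thesis by (simp add: left_diff_distrib)
    qed
    finally show ?thesis
      using nn_integral_eq_integral[OF i] K0 by (simp add: ennreal_leI)
  qed
  have "W1 P Q \<le> (\<integral>\<^sup>+x. \<integral>\<^sup>+y. ennreal (h x y) * ennreal (norm (x - y)) \<partial>Q \<partial>P)"
    by (rule W1_density_le[OF P Q meas_h hP hQ])
  also have "\<dots> \<le> (\<integral>\<^sup>+x. \<integral>\<^sup>+y. ennreal (k x y) \<partial>Q \<partial>P)"
    using h0 by (intro nn_integral_mono) (simp add: hk ennreal_leI flip: ennreal_mult)
  also have "\<dots> \<le> ennreal (\<delta> + an + bn)" using K_int by (simp add: k_int)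
  also have "\<delta> + an + bn \<le> \<delta> + (\<integral>x. s x * norm x \<partial>P) + (\<integral>x. s x * norm x \<partial>Q) + B * (\<Sum>i\<in>I. \<bar>p i - q i\<bar>)"
  proof -
    have sn: "integrable P (\<lambda>x. s x * norm x)" "integrable Q (\<lambda>x. s x * norm x)"
      unfolding s_def left_diff_distrib sum_distrib_right using int int_\<phi>n by auto
    have \<phi>B: "\<phi> i x * norm x \<le> \<phi> i x * B" if "i \<in> I" for i x
      using B[OF that, of x] nonneg[OF that, of x] by (cases "\<phi> i x = 0") auto
    \<comment> \<open>Every cell lies in the ball of radius \<open>B\<close>, so its unmatched mass
      costs at most \<open>B\<close> per unit.\<close>
    have ax: "a x * norm x \<le> s x * norm x + (\<Sum>i\<in>I. (1 - m i / p i) * (\<phi> i x * B))"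
      "b x * norm x \<le> s x * norm x + (\<Sum>i\<in>I. (1 - m i / q i) * (\<phi> i x * B))" for x
      unfolding a_eq b_eq distrib_right sum_distrib_right mult.assoc
      by (intro add_left_mono sum_mono mult_left_mono[OF \<phi>B]; use mp(7,8) in auto)+
    have "an \<le> (\<integral>x. s x * norm x + (\<Sum>i\<in>I. (1 - m i / p i) * (\<phi> i x * B)) \<partial>P)"
      unfolding an_def using int_an sn int_\<phi> ax by (intro integral_mono) auto
    also have "\<dots> = (\<integral>x. s x * norm x \<partial>P) + (\<Sum>i\<in>I. (1 - m i / p i) * (p i * B))"
      using sn int_\<phi> by (simp add: p_def)
    also have "(\<Sum>i\<in>I. (1 - m i / p i) * (p i * B)) = (\<Sum>i\<in>I. (p i - m i / p i * p i) * B)"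
      by (simp only: left_diff_distrib mult_1_left mult.assoc)
    also have "\<dots> = (\<Sum>i\<in>I. (p i - m i) * B)" by (intro sum.cong refl) (simp only: mp)
    finally have 1: "an \<le> (\<integral>x. s x * norm x \<partial>P) + (\<Sum>i\<in>I. (p i - m i) * B)" .
    have "bn \<le> (\<integral>x. s x * norm x + (\<Sum>i\<in>I. (1 - m i / q i) * (\<phi> i x * B)) \<partial>Q)"
      unfolding bn_def using int_an sn int_\<phi> ax by (intro integral_mono) auto
    also have "\<dots> = (\<integral>x. s x * norm x \<partial>Q) + (\<Sum>i\<in>I. (1 - m i / q i) * (q i * B))"
      using sn int_\<phi> by (simp add: q_def)
    also have "(\<Sum>i\<in>I. (1 - m i / q i) * (q i * B)) = (\<Sum>i\<in>I. (q i - m i / q i * q i) * B)"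
      by (simp only: left_diff_distrib mult_1_left mult.assoc)
    also have "\<dots> = (\<Sum>i\<in>I. (q i - m i) * B)" by (intro sum.cong refl) (simp only: mp)
    finally have 2: "bn \<le> (\<integral>x. s x * norm x \<partial>Q) + (\<Sum>i\<in>I. (q i - m i) * B)" .
    \<comment> \<open>As \<open>m i\<close> is the minimum, one excess vanishes and the other is the
      absolute difference.\<close>
    have "(\<Sum>i\<in>I. (p i - m i) * B) + (\<Sum>i\<in>I. (q i - m i) * B) = B * (\<Sum>i\<in>I. \<bar>p i - q i\<bar>)"
      unfolding sum_distrib_left sum.distrib[symmetric]
      by (intro sum.cong refl) (auto simp: m_def min_def algebra_simps)
    with 1 2 show ?thesis by linarith
  qed
  finally show ?thesis by (simp add: p_def q_def ennreal_leI)
qed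

text \<open>Tents of radius \<delta> around a finite \<delta>-net of the ball, normalized. Unlike
  indicators of cells they are continuous, so they can be tested by (iii).\<close>

lemma obtain_small_partition:
  fixes R \<delta> :: real
  assumes R: "R \<ge> 0" and \<delta>: "\<delta> > 0"
  obtains I :: "'a::euclidean_space set" and \<phi> :: "'a \<Rightarrow> 'a \<Rightarrow> real"
  where "finite I" "\<And>i. i \<in> I \<Longrightarrow> continuous_on UNIV (\<phi> i)" "\<And>i x. i \<in> I \<Longrightarrow> 0 \<le> \<phi> i x"
    "\<And>x. (\<Sum>i\<in>I. \<phi> i x) \<le> 1" "\<And>x. norm x \<le> R \<Longrightarrow> (\<Sum>i\<in>I. \<phi> i x) = 1"
    "\<And>i x. i \<in> I \<Longrightarrow> \<phi> i x \<noteq> 0 \<Longrightarrow> norm x \<le> R + \<delta>"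
    "\<And>i x y. i \<in> I \<Longrightarrow> \<phi> i x \<noteq> 0 \<Longrightarrow> \<phi> i y \<noteq> 0 \<Longrightarrow> norm (x - y) \<le> 2 * \<delta>"
proof -
  obtain I where I: "finite I" "I \<subseteq> cball (0::'a) R" "cball 0 R \<subseteq> (\<Union>c\<in>I. ball c \<delta>)"
    using compactE_image[OF compact_cball, of "cball (0::'a) R" "\<lambda>c. ball c \<delta>" 0 R] \<delta>
    by (metis centre_in_ball open_ball UN_I subsetI)
  define \<psi> :: "'a \<Rightarrow> 'a \<Rightarrow> real" where "\<psi> = (\<lambda>c x. max 0 (\<delta> - norm (x - c)))"
  \<comment> \<open>The extra summand vanishes on the ball, where the quotients must add up to 1;
    outside it keeps the divisor positive even where all tents are 0.\<close>
  define S where "S = (\<lambda>x. (\<Sum>c\<in>I. \<psi> c x) + max 0 (norm x - R))"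
  have \<psi>0: "0 \<le> \<psi> c x" for c x by (simp add: \<psi>_def)
  have S: "S x > 0" for x
  proof (cases "norm x \<le> R")
    case True
    then obtain c where c: "c \<in> I" "x \<in> ball c \<delta>" using I(3) by force
    then have "0 < \<psi> c x" by (auto simp: \<psi>_def dist_norm norm_minus_commute)
    also have "\<dots> \<le> (\<Sum>c\<in>I. \<psi> c x)" using I(1) c(1) \<psi>0 by (intro member_le_sum) auto
    finally show ?thesis by (simp add: S_def)
  next
    case False
    then show ?thesis using \<psi>0 by (auto simp: S_def intro!: add_nonneg_pos sum_nonneg)
  qed
  have supp: "norm (x - c) \<le> \<delta>" if "\<psi> c x / S x \<noteq> 0" for c x
    using that by (auto simp: \<psi>_def max_def split: if_splits)
  show thesis
  proof (rule that[of I "\<lambda>c x. \<psi> c x / S x"])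
    have *: "(\<Sum>c\<in>I. \<psi> c x / S x) = (\<Sum>c\<in>I. \<psi> c x) / S x" for x
      by (simp add: sum_divide_distrib)
    show "(\<Sum>c\<in>I. \<psi> c x / S x) \<le> 1" for x
      unfolding * using S[of x] by (simp add: pos_divide_le_eq) (simp add: S_def)
    show "(\<Sum>c\<in>I. \<psi> c x / S x) = 1" if "norm x \<le> R" for x
      unfolding * using S[of x] that by (simp add: S_def)
    show "continuous_on UNIV (\<lambda>x. \<psi> c x / S x)" for c
      using S less_imp_neq[OF S] unfolding \<psi>_def S_def
      by (intro continuous_intros) (metis less_irrefl)
    show "0 \<le> \<psi> c x / S x" for c x using \<psi>0 S[of x] by (simp add: less_imp_le)
    show "norm x \<le> R + \<delta>" if "c \<in> I" "\<psi> c x / S x \<noteq> 0" for c x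
      using supp[OF that(2)] I(2) that(1) norm_triangle_sub[of x c] by fastforce
    show "norm (x - y) \<le> 2 * \<delta>" if "\<psi> c x / S x \<noteq> 0" "\<psi> c y / S y \<noteq> 0" for c x y
      using supp[OF that(1)] supp[OF that(2)] norm_triangle_ineq4[of "x - c" "y - c"] by simp
  qed (use I in auto)
qed

text \<open>For a fixed partition the bound of \<open>W1_le_partition\<close> involves only
  expectations of finitely many functions in \<open>Dd\<close>. In the limit the mass differences
  vanish, leaving the cell diameter and twice a tail of X.\<close>

lemma W1_tendsto_0:
  fixes X :: "'b \<Rightarrow> 'a::euclidean_space"
  assumes M: "prob_space M" and X[measurable]: "X \<in> borel_measurable M" and Xn[measurable]: "\<And>n. Xn n \<in> borel_measurable M"
    and int: "\<And>n. integrable M (\<lambda>\<omega>. norm (Xn n \<omega>))" "integrable M (\<lambda>\<omega>. norm (X \<omega>))"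
    and conv: "\<And>f. f \<in> Dd \<Longrightarrow> (\<lambda>n. \<integral>\<omega>. f (Xn n \<omega>) \<partial>M) \<longlonglongrightarrow> (\<integral>\<omega>. f (X \<omega>) \<partial>M)"
  shows "(\<lambda>n. W1 (distr M borel (Xn n)) (distr M borel X)) \<longlonglongrightarrow> 0"
proof (rule order_tendstoI)
  interpret prob_space M by fact
  fix e :: ennreal assume "0 < e"
  then obtain \<eta> where \<eta>: "0 < \<eta>" "ennreal \<eta> \<le> e"
  proof (cases e)
    case (real r)
    with \<open>0 < e\<close> show ?thesis by (intro that[of r]) auto
  next
    case top
    then show ?thesis by (intro that[of 1]) auto
  qed
  \<comment> \<open>In general discontinuous, hence no test function for (iii); it is used for X
    alone, where dominated convergence applies.\<close>
  define tail where "tail = (\<lambda>k::nat. \<lambda>x::'a. norm x * indicator {x. real k < norm x} x)"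
  have "(\<lambda>k. \<integral>\<omega>. tail k (X \<omega>) \<partial>M) \<longlonglongrightarrow> (\<integral>\<omega>. 0 \<partial>M)"
  proof (rule integral_dominated_convergence)
    show "integrable M (\<lambda>\<omega>. norm (X \<omega>))" by (rule int)
    show "AE \<omega> in M. (\<lambda>k. tail k (X \<omega>)) \<longlonglongrightarrow> 0"
    proof (intro AE_I2 tendsto_eventually eventually_sequentiallyI)
      fix \<omega> k assume "nat \<lceil>norm (X \<omega>)\<rceil> \<le> k"
      then have "norm (X \<omega>) \<le> real k" by linarith
      then show "tail k (X \<omega>) = 0" by (simp add: tail_def)
    qed
  qed (auto simp: tail_def indicator_def)
  then have "\<forall>\<^sub>F k in sequentially. (\<integral>\<omega>. tail k (X \<omega>) \<partial>M) < \<eta> / 4"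
    using \<eta> by (intro order_tendstoD(2)) auto
  then obtain k where k: "(\<integral>\<omega>. tail k (X \<omega>) \<partial>M) < \<eta> / 4"
    by (auto dest: eventually_happens)
  \<comment> \<open>Cells of radius \<eta>/8 have diameter at most \<eta>/4; two tails below
    \<eta>/4 keep the limit of the bound under \<eta>.\<close>
  have \<eta>8: "0 < \<eta> / 8" using \<eta>(1) by simp
  obtain I :: "'a set" and \<phi> :: "'a \<Rightarrow> 'a \<Rightarrow> real" where I: "finite I"
    and cont: "\<And>i. i \<in> I \<Longrightarrow> continuous_on UNIV (\<phi> i)"
    and nonneg: "\<And>i x. i \<in> I \<Longrightarrow> 0 \<le> \<phi> i x"
    and le1: "\<And>x. (\<Sum>i\<in>I. \<phi> i x) \<le> 1"
    and eq1: "\<And>x. norm x \<le> real k \<Longrightarrow> (\<Sum>i\<in>I. \<phi> i x) = 1"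
    and B: "\<And>i x. i \<in> I \<Longrightarrow> \<phi> i x \<noteq> 0 \<Longrightarrow> norm x \<le> real k + \<eta> / 8"
    and diam: "\<And>i x y. i \<in> I \<Longrightarrow> \<phi> i x \<noteq> 0 \<Longrightarrow> \<phi> i y \<noteq> 0 \<Longrightarrow> norm (x - y) \<le> 2 * (\<eta> / 8)"
  proof (rule obtain_small_partition[where ?'a = 'a, OF of_nat_0_le_iff[of k] \<eta>8], goal_cases)
    case (1 I \<phi>)
    show ?case by (rule that[of I \<phi>]; fact 1)
  qed
  define s where "s = (\<lambda>x. 1 - (\<Sum>i\<in>I. \<phi> i x))"
  have s: "0 \<le> s x" "s x \<le> 1" for x using le1 nonneg by (auto simp: s_def intro!: sum_nonneg)
  have \<phi>1: "\<phi> i x \<le> 1" if "i \<in> I" for i x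
    using member_le_sum[OF that, of "\<lambda>i. \<phi> i x"] nonneg I le1[of x] by fastforce
  have \<phi>_Dd: "\<phi> i \<in> Dd" if "i \<in> I" for i
    using \<phi>1[OF that] nonneg[OF that] by (intro DdI[where C = 1] cont that) (auto simp: le_max_iff_disj)
  \<comment> \<open>Linear growth in \<open>Dd\<close> is what admits this function: it controls the
    first moment of \<open>Xn\<close> far out.\<close>
  have s_Dd: "(\<lambda>x. s x * norm x) \<in> Dd"
  proof (rule DdI[where C = 1])
    show "continuous_on UNIV (\<lambda>x. s x * norm x)"
      unfolding s_def by (intro continuous_intros cont)
    show "\<bar>s x * norm x\<bar> \<le> 1 * max 1 (norm x)" for x
      using s[of x] by (simp add: abs_mult le_max_iff_disj mult_left_le_one_le)
  qed
  have [measurable]: "\<phi> i \<in> borel_measurable borel" if "i \<in> I" for i using \<phi>_Dd[OF that] by (rule Dd_measurable)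
  have [measurable]: "s \<in> borel_measurable borel" unfolding s_def by measurable
  define w where "w = (\<lambda>n. 2 * (\<eta> / 8) + (\<integral>\<omega>. s (Xn n \<omega>) * norm (Xn n \<omega>) \<partial>M) + (\<integral>\<omega>. s (X \<omega>) * norm (X \<omega>) \<partial>M)
    + (real k + \<eta> / 8) * (\<Sum>i\<in>I. \<bar>(\<integral>\<omega>. \<phi> i (Xn n \<omega>) \<partial>M) - (\<integral>\<omega>. \<phi> i (X \<omega>) \<partial>M)\<bar>))"
  have W1_le: "W1 (distr M borel (Xn n)) (distr M borel X) \<le> ennreal (w n)" for n
  proof -
    have "W1 (distr M borel (Xn n)) (distr M borel X) \<le> ennreal (2 * (\<eta> / 8)
        + (\<integral>x. (1 - (\<Sum>i\<in>I. \<phi> i x)) * norm x \<partial>distr M borel (Xn n)) + (\<integral>x. (1 - (\<Sum>i\<in>I. \<phi> i x)) * norm x \<partial>distr M borel X)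
        + (real k + \<eta> / 8) * (\<Sum>i\<in>I. \<bar>(\<integral>x. \<phi> i x \<partial>distr M borel (Xn n)) - (\<integral>x. \<phi> i x \<partial>distr M borel X)\<bar>))"
      by (rule W1_le_partition)
         (use int I nonneg le1 B diam \<eta>(1) in \<open>auto simp: prob_space_distr integrable_distr_eq\<close>)
    also have "\<dots> = ennreal (w n)"
      by (simp add: w_def s_def integral_distr cong: sum.cong)
    finally show ?thesis .
  qed
  \<comment> \<open>The differences that are 0 are kept so that the limit matches \<open>w n\<close>
    term by term.\<close>
  define w' where "w' = 2 * (\<eta> / 8) + (\<integral>\<omega>. s (X \<omega>) * norm (X \<omega>) \<partial>M) + (\<integral>\<omega>. s (X \<omega>) * norm (X \<omega>) \<partial>M)
    + (real k + \<eta> / 8) * (\<Sum>i\<in>I. \<bar>(\<integral>\<omega>. \<phi> i (X \<omega>) \<partial>M) - (\<integral>\<omega>. \<phi> i (X \<omega>) \<partial>M)\<bar>)"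
  have w_lim: "w \<longlonglongrightarrow> w'"
    unfolding w_def w'_def by (intro tendsto_intros conv \<phi>_Dd conv[OF s_Dd])
  have "(\<integral>\<omega>. s (X \<omega>) * norm (X \<omega>) \<partial>M) \<le> (\<integral>\<omega>. tail k (X \<omega>) \<partial>M)"
  proof (rule integral_mono)
    show "integrable M (\<lambda>\<omega>. s (X \<omega>) * norm (X \<omega>))" by (rule integrable_Dd[OF s_Dd X int(2)])
    show "integrable M (\<lambda>\<omega>. tail k (X \<omega>))"
      unfolding tail_def by (intro Bochner_Integration.integrable_bound[OF int(2)]) (auto simp: indicator_def)
    show "s (X \<omega>) * norm (X \<omega>) \<le> tail k (X \<omega>)" for \<omega>
      using s[of "X \<omega>"] eq1[of "X \<omega>"]
      by (auto simp: tail_def s_def indicator_def mult_left_le_one_le)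
  qed
  moreover have "w' = \<eta> / 4 + 2 * (\<integral>\<omega>. s (X \<omega>) * norm (X \<omega>) \<partial>M)" by (simp add: w'_def)
  ultimately have "w' < \<eta>" using k \<eta>(1) by linarith
  then have "\<forall>\<^sub>F n in sequentially. w n < \<eta>" by (rule order_tendstoD(2)[OF w_lim])
  then show "\<forall>\<^sub>F n in sequentially. W1 (distr M borel (Xn n)) (distr M borel X) < e"
  proof eventually_elim
    case (elim n)
    have "W1 (distr M borel (Xn n)) (distr M borel X) \<le> ennreal (w n)" by (rule W1_le)
    also have "\<dots> < ennreal \<eta>" using \<eta>(1) elim by (rule ennreal_lessI)
    finally show ?case using \<eta>(2) by simp
  qed
qed auto

section \<open>Assembly of (a) and (b)\<close>

text \<open>In (b) two inequalities stand for the absolute value, because subtraction on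
  \<open>ennreal\<close> truncates; an infinite moment makes both trivial. The nonempty
  \<open>T\<close> expresses that an infimum over the empty set is infinite, as the real
  \<open>INF\<close> is unspecified there.\<close>

theorem theorem8:
  fixes M :: "'b measure"
    and X Y :: "'b \<Rightarrow> 'a::euclidean_space"
    and Xn :: "nat \<Rightarrow> 'b \<Rightarrow> 'a"
  assumes "prob_space M"
    and "X \<in> borel_measurable M" and "Y \<in> borel_measurable M"
    and "\<And>n. Xn n \<in> borel_measurable M"
  shows
   "((\<forall>n. integrable M (\<lambda>\<omega>. norm (Xn n \<omega>))) \<longrightarrow>
       (((\<lambda>n. W1 (distr M borel (Xn n)) (distr M borel X)) \<longlonglongrightarrow> 0)
          \<longleftrightarrow> ((\<lambda>n. W1_star (distr M borel (Xn n)) (distr M borel X)) \<longlonglongrightarrow> 0))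
     \<and> (((\<lambda>n. W1_star (distr M borel (Xn n)) (distr M borel X)) \<longlonglongrightarrow> 0)
          \<longleftrightarrow> (\<forall>f \<in> Dd. integrable M (\<lambda>\<omega>. f (X \<omega>)) \<and>
                 ((\<lambda>n. \<integral>\<omega>. f (Xn n \<omega>) \<partial>M) \<longlonglongrightarrow> (\<integral>\<omega>. f (X \<omega>) \<partial>M)))))
    \<and> (\<forall>(\<epsilon>::real) (T::'a set). \<epsilon> > 0 \<and> finite T \<and> T \<noteq> {} \<and> T \<subseteq> sphere 0 1 \<and>
          (SUP s \<in> sphere (0::'a) 1. INF t \<in> T. norm (s - t)) \<le> \<epsilon> \<longrightarrow>
        (let P = distr M borel X; Q = distr M borel Y;
             S = (SUP t \<in> T. W1 (proj_law t P) (proj_law t Q));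
             c = ennreal \<epsilon> * ((\<integral>\<^sup>+\<omega>. ennreal (norm (X \<omega>)) \<partial>M) + (\<integral>\<^sup>+\<omega>. ennreal (norm (Y \<omega>)) \<partial>M))
         in W1_star P Q \<le> S + c \<and> S \<le> W1_star P Q + c))"
proof (intro conjI allI impI)
  interpret prob_space M by fact
  let ?W = "\<lambda>n. W1 (distr M borel (Xn n)) (distr M borel X)"
  let ?W' = "\<lambda>n. W1_star (distr M borel (Xn n)) (distr M borel X)"
  let ?D = "\<forall>f \<in> Dd. integrable M (\<lambda>\<omega>. f (X \<omega>)) \<and> (\<lambda>n. \<integral>\<omega>. f (Xn n \<omega>) \<partial>M) \<longlonglongrightarrow> (\<integral>\<omega>. f (X \<omega>) \<partial>M)"
  assume "\<forall>n. integrable M (\<lambda>\<omega>. norm (Xn n \<omega>))"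
  then have int: "\<And>n. integrable M (\<lambda>\<omega>. norm (Xn n \<omega>))" by simp
  have 1: "?W' \<longlonglongrightarrow> 0" if "?W \<longlonglongrightarrow> 0"
    by (rule tendsto_sandwich[OF _ _ tendsto_const that]) (auto intro!: always_eventually W1_star_le_W1)
  have 2: ?D if W': "?W' \<longlonglongrightarrow> 0"
  proof -
    have "\<forall>\<^sub>F n in sequentially. ?W' n < \<infinity>"
      using W' by (rule order_tendstoD(2)) simp
    then obtain n where "?W' n < \<infinity>" by (auto dest: eventually_happens)
    then have X: "integrable M (\<lambda>\<omega>. norm (X \<omega>))"
      by (rule integrable_norm_of_W1_star[OF assms(1,2,4) _ int])
    show ?D
      by (intro ballI conjI integrable_Dd[OF _ assms(2) X] tendsto_expectation_Dd[OF assms(1,2,4) W' int X])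
  qed
  have 3: "?W \<longlonglongrightarrow> 0" if ?D
  proof (rule W1_tendsto_0)
    \<comment> \<open>The integrability conjunct at \<open>norm\<close> supplies the first moment of
      X.\<close>
    have "norm \<in> (Dd :: ('a \<Rightarrow> real) set)"
      by (rule DdI[where C = 1]) (auto intro: continuous_intros)
    with that show "integrable M (\<lambda>\<omega>. norm (X \<omega>))" by blast
  qed (use assms int that in auto)
  show "?W \<longlonglongrightarrow> 0 \<longleftrightarrow> ?W' \<longlonglongrightarrow> 0" "?W' \<longlonglongrightarrow> 0 \<longleftrightarrow> ?D"
    using 1 2 3 by blast+
next
  fix \<epsilon> :: real and T :: "'a set"
  assume T: "\<epsilon> > 0 \<and> finite T \<and> T \<noteq> {} \<and> T \<subseteq> sphere 0 1 \<and>
          (SUP s \<in> sphere (0::'a) 1. INF t \<in> T. norm (s - t)) \<le> \<epsilon>"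
  let ?P = "distr M borel X" and ?Q = "distr M borel Y"
  \<comment> \<open>This direction costs no \<epsilon>, since \<open>T\<close> lies in the
    sphere.\<close>
  have "(SUP t \<in> T. W1 (proj_law t ?P) (proj_law t ?Q)) \<le> W1_star ?P ?Q"
    unfolding W1_star_def using T by (intro SUP_subset_mono) auto
  then show "let P = distr M borel X; Q = distr M borel Y;
             S = (SUP t \<in> T. W1 (proj_law t P) (proj_law t Q));
             c = ennreal \<epsilon> * ((\<integral>\<^sup>+\<omega>. ennreal (norm (X \<omega>)) \<partial>M) + (\<integral>\<^sup>+\<omega>. ennreal (norm (Y \<omega>)) \<partial>M))
         in W1_star P Q \<le> S + c \<and> S \<le> W1_star P Q + c"
    unfolding Let_def using assms T
    by (intro conjI W1_star_le_SUP_net) (auto intro: order_trans)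
qed

end
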